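(* Let $x_a\in\mathbb{R}$ be fixed, let $L:[a,b]\times\mathbb{R}^2\to\mathbb{R}$ be differentiable and $\phi:[a,b]\times\mathbb{R}\to\mathbb{R}$ be of class $C^1$. Suppose that $(x,T)$ is a local minimizer of $$\mathcal{J}(x,T)=\int_a^T L[x]_\gamma^{\alpha,\beta}(t)\,dt+\phi(T,x(T))$$ on $D$, subject to the boundary condition $x(a)=x_a$ ($T$ and $x(T)$ being free). Then $(x,T)$ satisfies the fractional Euler--Lagrange equations $$\partial_2L[x]_\gamma^{\alpha,\beta}(t)+D_{\overline\gamma}^{\beta(\cdot,\cdot),\alpha(\cdot,\cdot)}\partial_3L[x]_\gamma^{\alpha,\beta}(t)=0$$ on the interval $[a,T]$, and $$\gamma_2\left({}_aD_t^{\beta(\cdot,\cdot)}\partial_3L[x]_\gamma^{\alpha,\beta}(t)-{}_TD_t^{\beta(\cdot,\cdot)}\partial_3L[x]_\gamma^{\alpha,\beta}(t)\right)=0$$ on the interval $[T,b]$. Moreover, $(x,T)$ satisfies the transversality conditions $$ \begin{cases} L[x]_\gamma^{\alpha,\beta}(T)+\partial_1\phi(T,x(T))+\partial_2\phi(T,x(T))\,x'(T)=0,\\ \left[\gamma_1\,{}_tI_T^{1-\alpha(\cdot,\cdot)}\partial_3L[x]_\gamma^{\alpha,\beta}(t)-\gamma_2\,{}_TI_t^{1-\beta(\cdot,\cdot)}\partial_3L[x]_\gamma^{\alpha,\beta}(t)\right]_{t=T}+\partial_2\phi(T,x(T))=0,\\ \gamma_2\left[{}_TI_t^{1-\beta(\cdot,\cdot)}\partial_3L[x]_\gamma^{\alpha,\beta}(t)-{}_aI_t^{1-\beta(\cdot,\cdot)}\partial_3L[x]_\gamma^{\alpha,\beta}(t)\right]_{t=b}=0.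 \end{cases} $$
   Context: Let $a<b$ be reals, $\alpha,\beta:[a,b]^2\to(0,1)$ continuous functions, and $\gamma=(\gamma_1,\gamma_2)\in[0,1]^2$ with $\gamma_1,\gamma_2$ not both zero; $\overline\gamma=(\gamma_2,\gamma_1)$. For $c\in[a,b]$ and $\delta\in\{\alpha,\beta\}$ define the variable-order Riemann--Liouville integrals $${}_cI_t^{1-\delta(\cdot,\cdot)}f(t)=\int_c^t\frac{(t-\tau)^{-\delta(t,\tau)}}{\Gamma(1-\delta(t,\tau))}f(\tau)\,d\tau\ (t>c),\qquad {}_tI_c^{1-\delta(\cdot,\cdot)}f(t)=\int_t^c\frac{(\tau-t)^{-\delta(\tau,t)}}{\Gamma(1-\delta(\tau,t))}f(\tau)\,d\tau\ (t<c),$$ the Riemann--Liouville derivatives ${}_cD_t^{\delta(\cdot,\cdot)}f(t)=\frac{d}{dt}\,{}_cI_t^{1-\delta(\cdot,\cdot)}f(t)$ and ${}_tD_c^{\delta(\cdot,\cdot)}f(t)=-\frac{d}{dt}\,{}_tI_c^{1-\delta(\cdot,\cdot)}f(t)$, and the Caputo derivatives ${}_a^CD_t^{\alpha(\cdot,\cdot)}x(t)={}_aI_t^{1-\alpha(\cdot,\cdot)}x'(t)$ and ${}_t^CD_b^{\beta(\cdot,\cdot)}x(t)=-{}_tI_b^{1-\beta(\cdot,\cdot)}x'(t)$. The combined Caputo fractional derivative is ${}^CD_\gamma^{\alpha(\cdot,\cdot),\beta(\cdot,\cdot)}x(t)=\gamma_1\,{}_a^CD_t^{\alpha(\cdot,\cdot)}x(t)+\gamma_2\,{}_t^CD_b^{\beta(\cdot,\cdot)}x(t)$,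 and the dual derivative is $D_{\overline\gamma}^{\beta(\cdot,\cdot),\alpha(\cdot,\cdot)}=\gamma_2\,{}_aD_t^{\beta(\cdot,\cdot)}+\gamma_1\,{}_tD_T^{\alpha(\cdot,\cdot)}$. Notation: $[x]_\gamma^{\alpha,\beta}(t)=\left(t,x(t),{}^CD_\gamma^{\alpha(\cdot,\cdot),\beta(\cdot,\cdot)}x(t)\right)$; $F[x]_\gamma^{\alpha,\beta}(t)$ means $F$ evaluated at this vector; $\partial_iF$ is the partial derivative with respect to the $i$th argument. $D=\{(x,t)\in C^1([a,b])\times[a,b]:\ {}^CD_\gamma^{\alpha(\cdot,\cdot),\beta(\cdot,\cdot)}x\in C([a,b])\}$, with norm $\|(x,t)\|=\max_{[a,b]}|x|+\max_{[a,b]}|{}^CD_\gamma^{\alpha(\cdot,\cdot),\beta(\cdot,\cdot)}x|+|t|$. $(x^\star,T^\star)$ is a local minimizer if for some $\epsilon>0$, $\mathcal{J}(x^\star,T^\star)\le\mathcal{J}(x,T)$ for all admissible $(x,T)\in D$ with $\|(x^\star,T^\star)-(x,T)\|<\epsilon$.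
   Formalization: The formal theorem assumes that ∂₂L and ∂₃L are continuous (differentiability of L alone is not enough) and that a<T<b (the claim fails at T=b); the Euler–Lagrange equations are asserted at those t where the Riemann–Liouville derivatives in them exist. *)

theory Defs
  imports "HOL-Analysis.Analysis"
begin

(* The integrals of order 1 - delta. At t = c the domain of integration is a null set, so both
   operators take there the value 0. *)
definition left_RL_integral :: "(real \<Rightarrow> real \<Rightarrow> real) \<Rightarrow> real \<Rightarrow> (real \<Rightarrow> real) \<Rightarrow> real \<Rightarrow> real" where
  "left_RL_integral \<delta> c f t =
     (LBINT \<tau>:{c..t}. (t - \<tau>) powr (- \<delta> t \<tau>) / Gamma (1 - \<delta> t \<tau>) * f \<tau>)"

definition right_RL_integral :: "(real \<Rightarrow> real \<Rightarrow> real) \<Rightarrow> real \<Rightarrow> (real \<Rightarrow> real) \<Rightarrow> real \<Rightarrow> real" where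
  "right_RL_integral \<delta> c f t =
     (LBINT \<tau>:{t..c}. (\<tau> - t) powr (- \<delta> \<tau> t) / Gamma (1 - \<delta> \<tau> t) * f \<tau>)"

(* d/dt on a compact interval I: the usual derivative at interior points, the one-sided one at the
   two end points. *)
definition deriv_on :: "real set \<Rightarrow> (real \<Rightarrow> real) \<Rightarrow> real \<Rightarrow> real" where
  "deriv_on I f t = vector_derivative f (at t within I)"

(* The derivatives are total functions whose value is arbitrary where the fractional integral is
   not differentiable; the accompanying predicates say that they exist. *)
definition left_RL_deriv ::
    "real set \<Rightarrow> (real \<Rightarrow> real \<Rightarrow> real) \<Rightarrow> real \<Rightarrow> (real \<Rightarrow> real) \<Rightarrow> real \<Rightarrow> real" where
  "left_RL_deriv I \<delta> c f t = deriv_on I (left_RL_integral \<delta> c f) t"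

definition left_RL_differentiable ::
    "real set \<Rightarrow> (real \<Rightarrow> real \<Rightarrow> real) \<Rightarrow> real \<Rightarrow> (real \<Rightarrow> real) \<Rightarrow> real \<Rightarrow> bool" where
  "left_RL_differentiable I \<delta> c f t \<longleftrightarrow> left_RL_integral \<delta> c f differentiable (at t within I)"

definition right_RL_deriv ::
    "real set \<Rightarrow> (real \<Rightarrow> real \<Rightarrow> real) \<Rightarrow> real \<Rightarrow> (real \<Rightarrow> real) \<Rightarrow> real \<Rightarrow> real" where
  "right_RL_deriv I \<delta> c f t = - deriv_on I (right_RL_integral \<delta> c f) t"

definition right_RL_differentiable ::
    "real set \<Rightarrow> (real \<Rightarrow> real \<Rightarrow> real) \<Rightarrow> real \<Rightarrow> (real \<Rightarrow> real) \<Rightarrow> real \<Rightarrow> bool" where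
  "right_RL_differentiable I \<delta> c f t \<longleftrightarrow> right_RL_integral \<delta> c f differentiable (at t within I)"

definition left_Caputo_deriv ::
    "real \<Rightarrow> real \<Rightarrow> (real \<Rightarrow> real \<Rightarrow> real) \<Rightarrow> (real \<Rightarrow> real) \<Rightarrow> real \<Rightarrow> real" where
  "left_Caputo_deriv a b \<alpha> x t = left_RL_integral \<alpha> a (deriv_on {a..b} x) t"

definition right_Caputo_deriv ::
    "real \<Rightarrow> real \<Rightarrow> (real \<Rightarrow> real \<Rightarrow> real) \<Rightarrow> (real \<Rightarrow> real) \<Rightarrow> real \<Rightarrow> real" where
  "right_Caputo_deriv a b \<beta> x t = - right_RL_integral \<beta> b (deriv_on {a..b} x) t"

definition combined_Caputo_deriv ::
    "real \<Rightarrow> real \<Rightarrow> (real \<Rightarrow> real \<Rightarrow> real) \<Rightarrow> (real \<Rightarrow> real \<Rightarrow> real) \<Rightarrow> real \<Rightarrow> real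
      \<Rightarrow> (real \<Rightarrow> real) \<Rightarrow> real \<Rightarrow> real" where
  "combined_Caputo_deriv a b \<alpha> \<beta> \<gamma>\<^sub>1 \<gamma>\<^sub>2 x t =
     \<gamma>\<^sub>1 * left_Caputo_deriv a b \<alpha> x t + \<gamma>\<^sub>2 * right_Caputo_deriv a b \<beta> x t"

definition dual_deriv ::
    "real \<Rightarrow> real \<Rightarrow> (real \<Rightarrow> real \<Rightarrow> real) \<Rightarrow> (real \<Rightarrow> real \<Rightarrow> real) \<Rightarrow> real \<Rightarrow> real
      \<Rightarrow> (real \<Rightarrow> real) \<Rightarrow> real \<Rightarrow> real" where
  "dual_deriv a T \<alpha> \<beta> \<gamma>\<^sub>1 \<gamma>\<^sub>2 f t =
     \<gamma>\<^sub>2 * left_RL_deriv {a..T} \<beta> a f t + \<gamma>\<^sub>1 * right_RL_deriv {a..T} \<alpha> T f t"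

(* A derivative with coefficient 0 does not occur in the sum and need not exist. *)
definition dual_differentiable ::
    "real \<Rightarrow> real \<Rightarrow> (real \<Rightarrow> real \<Rightarrow> real) \<Rightarrow> (real \<Rightarrow> real \<Rightarrow> real) \<Rightarrow> real \<Rightarrow> real
      \<Rightarrow> (real \<Rightarrow> real) \<Rightarrow> real \<Rightarrow> bool" where
  "dual_differentiable a T \<alpha> \<beta> \<gamma>\<^sub>1 \<gamma>\<^sub>2 f t \<longleftrightarrow>
     (\<gamma>\<^sub>2 \<noteq> 0 \<longrightarrow> left_RL_differentiable {a..T} \<beta> a f t) \<and>
     (\<gamma>\<^sub>1 \<noteq> 0 \<longrightarrow> right_RL_differentiable {a..T} \<alpha> T f t)"

definition C1_on_interval :: "real \<Rightarrow> real \<Rightarrow> (real \<Rightarrow> real) \<Rightarrow> bool" where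
  "C1_on_interval a b x \<longleftrightarrow> x differentiable_on {a..b} \<and> continuous_on {a..b} (deriv_on {a..b} x)"

(* Membership of (x,T) in the space D. *)
definition in_D ::
    "real \<Rightarrow> real \<Rightarrow> (real \<Rightarrow> real \<Rightarrow> real) \<Rightarrow> (real \<Rightarrow> real \<Rightarrow> real) \<Rightarrow> real \<Rightarrow> real
      \<Rightarrow> (real \<Rightarrow> real) \<Rightarrow> real \<Rightarrow> bool" where
  "in_D a b \<alpha> \<beta> \<gamma>\<^sub>1 \<gamma>\<^sub>2 x T \<longleftrightarrow>
     C1_on_interval a b x \<and> T \<in> {a..b} \<and>
     continuous_on {a..b} (combined_Caputo_deriv a b \<alpha> \<beta> \<gamma>\<^sub>1 \<gamma>\<^sub>2 x)"

(* The suprema are maxima for (x,T) in D. *)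
definition D_norm ::
    "real \<Rightarrow> real \<Rightarrow> (real \<Rightarrow> real \<Rightarrow> real) \<Rightarrow> (real \<Rightarrow> real \<Rightarrow> real) \<Rightarrow> real \<Rightarrow> real
      \<Rightarrow> (real \<Rightarrow> real) \<Rightarrow> real \<Rightarrow> real" where
  "D_norm a b \<alpha> \<beta> \<gamma>\<^sub>1 \<gamma>\<^sub>2 x T =
     (SUP t\<in>{a..b}. \<bar>x t\<bar>) + (SUP t\<in>{a..b}. \<bar>combined_Caputo_deriv a b \<alpha> \<beta> \<gamma>\<^sub>1 \<gamma>\<^sub>2 x t\<bar>) + \<bar>T\<bar>"

(* F[x](t) = F(t, x(t), combined Caputo derivative of x at t) *)
definition along ::
    "real \<Rightarrow> real \<Rightarrow> (real \<Rightarrow> real \<Rightarrow> real) \<Rightarrow> (real \<Rightarrow> real \<Rightarrow> real) \<Rightarrow> real \<Rightarrow> real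
      \<Rightarrow> (real \<Rightarrow> real \<Rightarrow> real \<Rightarrow> real) \<Rightarrow> (real \<Rightarrow> real) \<Rightarrow> real \<Rightarrow> real" where
  "along a b \<alpha> \<beta> \<gamma>\<^sub>1 \<gamma>\<^sub>2 F x t = F t (x t) (combined_Caputo_deriv a b \<alpha> \<beta> \<gamma>\<^sub>1 \<gamma>\<^sub>2 x t)"

definition J_functional ::
    "real \<Rightarrow> real \<Rightarrow> (real \<Rightarrow> real \<Rightarrow> real) \<Rightarrow> (real \<Rightarrow> real \<Rightarrow> real) \<Rightarrow> real \<Rightarrow> real
      \<Rightarrow> (real \<Rightarrow> real \<Rightarrow> real \<Rightarrow> real) \<Rightarrow> (real \<Rightarrow> real \<Rightarrow> real) \<Rightarrow> (real \<Rightarrow> real) \<Rightarrow> real \<Rightarrow> real" where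
  "J_functional a b \<alpha> \<beta> \<gamma>\<^sub>1 \<gamma>\<^sub>2 L \<phi> x T =
     (LBINT t:{a..T}. along a b \<alpha> \<beta> \<gamma>\<^sub>1 \<gamma>\<^sub>2 L x t) + \<phi> T (x T)"

definition local_minimizer ::
    "real \<Rightarrow> real \<Rightarrow> (real \<Rightarrow> real \<Rightarrow> real) \<Rightarrow> (real \<Rightarrow> real \<Rightarrow> real) \<Rightarrow> real \<Rightarrow> real
      \<Rightarrow> (real \<Rightarrow> real \<Rightarrow> real \<Rightarrow> real) \<Rightarrow> (real \<Rightarrow> real \<Rightarrow> real) \<Rightarrow> real \<Rightarrow> (real \<Rightarrow> real) \<Rightarrow> real \<Rightarrow> bool" where
  "local_minimizer a b \<alpha> \<beta> \<gamma>\<^sub>1 \<gamma>\<^sub>2 L \<phi> x\<^sub>a x T \<longleftrightarrow>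
     in_D a b \<alpha> \<beta> \<gamma>\<^sub>1 \<gamma>\<^sub>2 x T \<and> x a = x\<^sub>a \<and>
     (\<exists>\<epsilon>>0. \<forall>y S. in_D a b \<alpha> \<beta> \<gamma>\<^sub>1 \<gamma>\<^sub>2 y S \<and> y a = x\<^sub>a \<and>
        D_norm a b \<alpha> \<beta> \<gamma>\<^sub>1 \<gamma>\<^sub>2 (\<lambda>t. x t - y t) (T - S) < \<epsilon> \<longrightarrow>
        J_functional a b \<alpha> \<beta> \<gamma>\<^sub>1 \<gamma>\<^sub>2 L \<phi> x T \<le> J_functional a b \<alpha> \<beta> \<gamma>\<^sub>1 \<gamma>\<^sub>2 L \<phi> y S)"

definition D2L :: "(real \<Rightarrow> real \<Rightarrow> real \<Rightarrow> real) \<Rightarrow> real \<Rightarrow> real \<Rightarrow> real \<Rightarrow> real" where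
  "D2L L t y v = deriv (\<lambda>z. L t z v) y"

definition D3L :: "(real \<Rightarrow> real \<Rightarrow> real \<Rightarrow> real) \<Rightarrow> real \<Rightarrow> real \<Rightarrow> real \<Rightarrow> real" where
  "D3L L t y v = deriv (\<lambda>w. L t y w) v"

definition D1phi :: "real \<Rightarrow> real \<Rightarrow> (real \<Rightarrow> real \<Rightarrow> real) \<Rightarrow> real \<Rightarrow> real \<Rightarrow> real" where
  "D1phi a b \<phi> t y = deriv_on {a..b} (\<lambda>s. \<phi> s y) t"

definition D2phi :: "(real \<Rightarrow> real \<Rightarrow> real) \<Rightarrow> real \<Rightarrow> real \<Rightarrow> real" where
  "D2phi \<phi> t y = deriv (\<lambda>z. \<phi> t z) y"

definition C1_terminal_cost :: "real \<Rightarrow> real \<Rightarrow> (real \<Rightarrow> real \<Rightarrow> real) \<Rightarrow> bool" where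
  "C1_terminal_cost a b \<phi> \<longleftrightarrow>
     (\<lambda>(t, y). \<phi> t y) differentiable_on ({a..b} \<times> UNIV) \<and>
     continuous_on ({a..b} \<times> UNIV) (\<lambda>(t, y). D1phi a b \<phi> t y) \<and>
     continuous_on ({a..b} \<times> UNIV) (\<lambda>(t, y). D2phi \<phi> t y)"

end

theory Submission
  imports Defs
begin

text \<open>Every perturbation of \<open>x\<close> that keeps \<open>x(a)\<close> has velocity \<open>g\<close> for some continuous \<open>g\<close>, and moving
  along it keeps the pair in \<open>D\<close>, because the kernels are dominated by one integrable function
  of \<open>s - t\<close>. Differentiating at the minimizer and exchanging the order of integration moves all
  fractional operators onto \<open>\<partial>\<^sub>3L\<close> and leaves \<open>\<integral> g W = 0\<close> on \<open>[a,b]\<close> with \<open>W\<close> continuous on \<open>[a,T]\<close>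
  and on \<open>[T,b]\<close>. Hence \<open>W\<close> vanishes on both pieces. These are the Euler--Lagrange equations in
  integrated form: they differentiate to the stated ones, and their values at \<open>T\<close> and \<open>b\<close> give the
  last two transversality conditions. The first one is stationarity of \<open>S \<mapsto> J(x,S)\<close> at \<open>T\<close>.\<close>

section \<open>Riemann--Liouville integrals of variable order\<close>

text \<open>The function p, that is \<partial>_3 L along \<open>x\<close>, is merely continuous, so
  its Riemann-Liouville integrals need not be differentiable and the variation cannot be brought
  directly to the differential form. Testing with the velocity \<open>g\<close>, in the manner of du
  Bois-Reymond, leaves only integrals of p. The variation of \<open>x\<close> at \<open>T\<close> is
  then the integral of \<open>g\<close>, so the terminal cost enters W as a constant and needs no
  separate endpoint variation. The equation on [T,b] is due to nonlocality: the cost stops at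
  \<open>T\<close>, but the right Caputo derivative at a time before \<open>T\<close> looks ahead to
  \<open>b\<close>. Its integration by parts takes place on [a,b] with p cut off at
  \<open>T\<close>. The cut-off is discontinuous, hence Fubini is set up for bounded measurable
  functions.\<close>

definition RL_kernel :: "(real \<Rightarrow> real \<Rightarrow> real) \<Rightarrow> real \<Rightarrow> real \<Rightarrow> real" where
  "RL_kernel \<delta> s t = (s - t) powr (- \<delta> s t) / Gamma (1 - \<delta> s t)"

text \<open>In HOL \<open>0 powr y = 0\<close> for every \<open>y\<close>, so the singularity is
  replaced by the value 0. The later time is always the first argument of the kernel: left and right
  integrals are the two partial integrals of one kernel.\<close>

lemma RL_kernel_diag [simp]: "RL_kernel \<delta> t t = 0"
  by (simp add: RL_kernel_def)

lemma left_RL_integral_kernel: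
  "left_RL_integral \<delta> c f t = (LBINT \<tau>:{c..t}. RL_kernel \<delta> t \<tau> * f \<tau>)"
  by (simp add: left_RL_integral_def RL_kernel_def)

lemma right_RL_integral_kernel:
  "right_RL_integral \<delta> c f t = (LBINT \<tau>:{t..c}. RL_kernel \<delta> \<tau> t * f \<tau>)"
  by (simp add: right_RL_integral_def RL_kernel_def)

text \<open>The substitution \<open>u = - \<tau>\<close> turns the earlier time into the later one,
  so the order has its arguments both negated and transposed. Continuity and integrability for right
  integrals are inherited from left ones in this way.\<close>

lemma right_RL_integral_reflect:
  "right_RL_integral \<delta> c f t
     = left_RL_integral (\<lambda>s u. \<delta> (- u) (- s)) (- c) (\<lambda>s. f (- s)) (- t)"
proof -
  have "(\<integral>\<tau>. indicator {t..c} \<tau> *\<^sub>R (RL_kernel \<delta> \<tau> t * f \<tau>) \<partial>lborel)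
      = (\<integral>u. indicator {t..c} (- u) *\<^sub>R (RL_kernel \<delta> (- u) t * f (- u)) \<partial>lborel)"
    by (subst lborel_integral_real_affine[where c = "- 1" and t = 0]) auto
  also have "\<dots> = (\<integral>u. indicator {- c..- t} u *\<^sub>R
      (RL_kernel (\<lambda>s u. \<delta> (- u) (- s)) (- t) u * f (- u)) \<partial>lborel)"
    by (intro Bochner_Integration.integral_cong)
      (auto simp: indicator_def RL_kernel_def minus_diff_commute)
  finally show ?thesis
    by (simp add: right_RL_integral_kernel left_RL_integral_kernel set_lebesgue_integral_def)
qed

lemma left_RL_integral_cong:
  assumes "\<And>\<tau>. c \<le> \<tau> \<Longrightarrow> \<tau> \<le> t \<Longrightarrow> f \<tau> = g \<tau>"
  shows "left_RL_integral \<delta> c f t = left_RL_integral \<delta> c g t"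
  unfolding left_RL_integral_def using assms by (intro set_lebesgue_integral_cong) auto

lemma right_RL_integral_cong:
  assumes "\<And>\<tau>. t \<le> \<tau> \<Longrightarrow> \<tau> \<le> c \<Longrightarrow> f \<tau> = g \<tau>"
  shows "right_RL_integral \<delta> c f t = right_RL_integral \<delta> c g t"
  unfolding right_RL_integral_def using assms by (intro set_lebesgue_integral_cong) auto

lemma continuous_on_Icc_bounded:
  fixes f :: "real \<Rightarrow> real"
  assumes "continuous_on {c..d} f"
  obtains M where "0 \<le> M" "\<And>\<tau>. \<tau> \<in> {c..d} \<Longrightarrow> \<bar>f \<tau>\<bar> \<le> M"
proof -
  have "bounded (f ` {c..d})"
    using assms by (intro compact_imp_bounded compact_continuous_image) auto
  then obtain M where "\<And>\<tau>. \<tau> \<in> {c..d} \<Longrightarrow> \<bar>f \<tau>\<bar> \<le> M"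
    unfolding bounded_iff real_norm_def by blast
  then show ?thesis
    by (intro that[of "\<bar>M\<bar>"]) force+
qed

lemma set_borel_measurable_continuous_Icc:
  fixes f :: "real \<Rightarrow> real"
  assumes "continuous_on {c..d} f"
  shows "set_borel_measurable borel {c..d} f"
  unfolding set_borel_measurable_def
  using assms by (intro borel_measurable_continuous_on_indicator) auto

section \<open>Kernels of variable order: a common majorant, continuity and duality of the
  integrals\<close>

locale variable_order =
  fixes a b :: real and \<delta> :: "real \<Rightarrow> real \<Rightarrow> real"
  assumes cont: "continuous_on ({a..b} \<times> {a..b}) (\<lambda>(s, t). \<delta> s t)"
    and range: "\<And>s t. s \<in> {a..b} \<Longrightarrow> t \<in> {a..b} \<Longrightarrow> \<delta> s t \<in> {0<..<1}"
begin

lemma restrict: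
  assumes "a \<le> c" "d \<le> b"
  shows "variable_order c d \<delta>"
  using assms by unfold_locales (auto intro!: continuous_on_subset[OF cont] range[simplified])

lemma reflect: "variable_order (- b) (- a) (\<lambda>s u. \<delta> (- u) (- s))"
proof
  show "continuous_on ({- b..- a} \<times> {- b..- a}) (\<lambda>(s, t). \<delta> (- t) (- s))"
    using continuous_on_compose2[OF cont,
        of "{- b..- a} \<times> {- b..- a}" "\<lambda>p. (- snd p, - fst p)"]
    by (force simp: case_prod_beta intro!: continuous_intros)
qed (use range in auto)

text \<open>Strictness of \<open>t < s\<close> matters: the kernel tends to infinity at the
  diagonal, where its value is 0. Off the diagonal the base of the power is positive, and
  \<open>1 - \<delta> s t > 0\<close> keeps Gamma continuous and nonzero.\<close>

lemma kernel_continuous: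
  "continuous_on {(s, t). a \<le> t \<and> t < s \<and> s \<le> b} (\<lambda>(s, t). RL_kernel \<delta> s t)"
proof -
  let ?S = "{(s, t). a \<le> t \<and> t < s \<and> s \<le> b}"
  have d: "continuous_on ?S (\<lambda>p. \<delta> (fst p) (snd p))"
    unfolding case_prod_beta[symmetric] by (rule continuous_on_subset[OF cont]) auto
  have r: "0 < 1 - \<delta> s t" if "(s, t) \<in> ?S" for s t
    using range[of s t] that by auto
  have G: "continuous_on ?S (\<lambda>p. Gamma (1 - \<delta> (fst p) (snd p)))"
  proof (rule continuous_on_compose2[of "{0<..}" Gamma])
    show "continuous_on {0<..} (Gamma :: real \<Rightarrow> real)"
      by (rule continuous_on_Gamma) (auto elim!: nonpos_Ints_cases)
  qed (use r in \<open>auto intro!: continuous_intros d\<close>)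
  have pos: "\<forall>p\<in>?S. Gamma (1 - \<delta> (fst p) (snd p)) \<noteq> 0"
    using Gamma_real_pos[OF r] by fastforce
  have "continuous_on ?S (\<lambda>p. (fst p - snd p) powr (- \<delta> (fst p) (snd p))
      / Gamma (1 - \<delta> (fst p) (snd p)))"
    by (intro continuous_intros d G pos) auto
  then show ?thesis
    by (simp add: RL_kernel_def case_prod_beta)
qed

text \<open>By compactness the order has a maximum \<open>e < 1\<close> and the reciprocal of Gamma
  a maximum \<open>C\<close>, and \<open>u powr (- e)\<close> is integrable at 0. That the bound
  depends on \<open>s - t\<close> alone makes it uniform in \<open>t\<close> after a shift, and
  gives it the same integral for every \<open>s\<close> in Fubini's theorem.\<close>

lemma kernel_majorant:
  obtains w :: "real \<Rightarrow> real" where "integrable lborel w" "\<And>u. 0 \<le> w u"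
    "\<And>s t. a \<le> t \<Longrightarrow> t \<le> s \<Longrightarrow> s \<le> b \<Longrightarrow> \<bar>RL_kernel \<delta> s t\<bar> \<le> w (s - t)"
proof (cases "a \<le> b")
  case False
  then show ?thesis
    by (intro that[of "\<lambda>_. 0"]) auto
next
  case True
  let ?Q = "{a..b} \<times> {a..b}"
  have ne: "compact ?Q" "?Q \<noteq> {}"
    using True by (auto intro: compact_Times)
  have d: "continuous_on ?Q (\<lambda>p. \<delta> (fst p) (snd p))"
    using cont by (auto simp: case_prod_beta)
  have r: "0 < \<delta> s t" "\<delta> s t < 1" if "(s, t) \<in> ?Q" for s t
    using range[of s t] that by auto
  have "continuous_on ?Q (\<lambda>p. Gamma (1 - \<delta> (fst p) (snd p)))"
  proof (rule continuous_on_compose2[of "{0<..}" Gamma])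
    show "continuous_on {0<..} (Gamma :: real \<Rightarrow> real)"
      by (rule continuous_on_Gamma) (auto elim!: nonpos_Ints_cases)
  qed (use r in \<open>auto intro!: continuous_intros d\<close>)
  moreover have pos: "0 < Gamma (1 - \<delta> s t)" if "(s, t) \<in> ?Q" for s t
    using r[OF that] by (intro Gamma_real_pos) auto
  ultimately have "continuous_on ?Q (\<lambda>p. 1 / Gamma (1 - \<delta> (fst p) (snd p)))"
    by (intro continuous_intros) force+
  then obtain p where "p \<in> ?Q"
    and p: "\<And>q. q \<in> ?Q \<Longrightarrow>
      1 / Gamma (1 - \<delta> (fst q) (snd q)) \<le> 1 / Gamma (1 - \<delta> (fst p) (snd p))"
    using continuous_attains_sup[of ?Q "\<lambda>p. 1 / Gamma (1 - \<delta> (fst p) (snd p))"] ne by blast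
  obtain q where "q \<in> ?Q"
    and q: "\<And>q'. q' \<in> ?Q \<Longrightarrow> \<delta> (fst q') (snd q') \<le> \<delta> (fst q) (snd q)"
    using continuous_attains_sup[OF _ _ d] ne by blast
  define C where "C = 1 / Gamma (1 - \<delta> (fst p) (snd p))"
  define e where "e = \<delta> (fst q) (snd q)"
  have e: "0 < e" "e < 1"
    using r[of "fst q" "snd q"] \<open>q \<in> ?Q\<close> by (auto simp: e_def)
  have C: "0 \<le> C"
    using pos[of "fst p" "snd p"] \<open>p \<in> ?Q\<close> by (auto simp: C_def)
  (* (s - t) powr (- \<delta> s t) is at most 1 if s - t \<ge> 1, and at most (s - t) powr (- e) otherwise *)
  define w where "w u = indicator {0..b - a} u *\<^sub>R (C * (1 + u powr (- e)))" for u
  \<comment> \<open>Gauge integrability and nonnegativity give integrability for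
    \<open>lebesgue\<close>; Borel measurability brings it down to \<open>lborel\<close>.\<close>
  have "(\<lambda>u. C * (1 + u powr (- e))) integrable_on {0..b - a}"
    using e True by (intro integrable_on_mult_right integrable_add integrable_const_ivl
        integrable_on_powr_from_0) auto
  then have "(\<lambda>u. C * (1 + u powr (- e))) absolutely_integrable_on {0..b - a}"
    using C by (intro nonnegative_absolutely_integrable_1) auto
  then have "integrable lebesgue w"
    by (simp add: set_integrable_def w_def[abs_def])
  moreover have "w \<in> borel_measurable lborel"
    unfolding w_def by measurable
  ultimately have "integrable lborel w"
    using integrable_completion by blast
  moreover have "0 \<le> w u" for u
    using C by (auto simp: w_def indicator_def)
  moreover have "\<bar>RL_kernel \<delta> s t\<bar> \<le> w (s - t)" if st: "a \<le> t" "t \<le> s" "s \<le> b" for s t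
  proof (cases "s = t")
    case True
    then show ?thesis using \<open>0 \<le> w (s - t)\<close> by simp
  next
    case False
    have Q: "(s, t) \<in> ?Q" using st by auto
    have "(s - t) powr (- \<delta> s t) \<le> 1 + (s - t) powr (- e)"
    proof (cases "1 \<le> s - t")
      case True
      then have "(s - t) powr (- \<delta> s t) \<le> (s - t) powr 0"
        using r[OF Q] by (intro powr_mono) auto
      also have "(s - t) powr 0 \<le> 1 + (s - t) powr (- e)"
        using st \<open>s \<noteq> t\<close> by simp
      finally show ?thesis .
    next
      case False
      then have "(s - t) powr (- \<delta> s t) \<le> (s - t) powr (- e)"
        using q[OF Q] st \<open>s \<noteq> t\<close> by (intro powr_mono') (auto simp: e_def)
      then show ?thesis by auto
    qed
    moreover have "1 / Gamma (1 - \<delta> s t) \<le> C"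
      using p[OF Q] by (auto simp: C_def)
    ultimately have "(s - t) powr (- \<delta> s t) * (1 / Gamma (1 - \<delta> s t))
        \<le> (1 + (s - t) powr (- e)) * C"
      using pos[OF Q] by (intro mult_mono) auto
    moreover have "0 \<le> RL_kernel \<delta> s t"
      using pos[OF Q] by (simp add: RL_kernel_def)
    ultimately show ?thesis
      using st by (simp add: RL_kernel_def w_def mult.commute)
  qed
  ultimately show ?thesis
    using that by blast
qed

lemma left_measurable:
  assumes f: "set_borel_measurable borel {a..b} f" and t: "t \<in> {a..b}"
  shows "(\<lambda>\<tau>. indicator {a..t} \<tau> *\<^sub>R (RL_kernel \<delta> t \<tau> * f \<tau>)) \<in> borel_measurable borel"
proof -
  have "continuous_on {a..<t} (RL_kernel \<delta> t)"
    using t by (intro continuous_on_compose2[OF kernel_continuous,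
          of _ "\<lambda>\<tau>. (t, \<tau>)", simplified]) (auto intro!: continuous_intros)
  then have [measurable]: "(\<lambda>\<tau>. indicator {a..<t} \<tau> *\<^sub>R RL_kernel \<delta> t \<tau>) \<in> borel_measurable borel"
    by (intro borel_measurable_continuous_on_indicator) auto
  have [measurable]: "(\<lambda>\<tau>. indicator {a..b} \<tau> *\<^sub>R f \<tau>) \<in> borel_measurable borel"
    using f by (simp add: set_borel_measurable_def)
  \<comment> \<open>The endpoint \<open>t\<close>, where the kernel is 0, may be dropped; on the
    remaining half-open interval the kernel is continuous.\<close>
  have "(\<lambda>\<tau>. indicator {a..t} \<tau> *\<^sub>R (RL_kernel \<delta> t \<tau> * f \<tau>))
      = (\<lambda>\<tau>. (indicator {a..<t} \<tau> *\<^sub>R RL_kernel \<delta> t \<tau>) * (indicator {a..b} \<tau> *\<^sub>R f \<tau>))"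
    using t by (auto simp: indicator_def fun_eq_iff)
  moreover have "(\<lambda>\<tau>. (indicator {a..<t} \<tau> *\<^sub>R RL_kernel \<delta> t \<tau>) * (indicator {a..b} \<tau> *\<^sub>R f \<tau>))
      \<in> borel_measurable borel"
    by measurable
  ultimately show ?thesis by metis
qed

lemma left_integrable:
  assumes f: "set_borel_measurable borel {a..b} f" and M: "\<And>\<tau>. \<tau> \<in> {a..b} \<Longrightarrow> \<bar>f \<tau>\<bar> \<le> M"
    and t: "t \<in> {a..b}"
  shows "set_integrable lborel {a..t} (\<lambda>\<tau>. RL_kernel \<delta> t \<tau> * f \<tau>)"
proof -
  obtain w :: "real \<Rightarrow> real" where w: "integrable lborel w" "\<And>u. 0 \<le> w u"
    "\<And>s t. a \<le> t \<Longrightarrow> t \<le> s \<Longrightarrow> s \<le> b \<Longrightarrow> \<bar>RL_kernel \<delta> s t\<bar> \<le> w (s - t)"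
    using kernel_majorant by metis
  have M0: "0 \<le> M" using M[OF t] by auto
  have "integrable lborel (\<lambda>\<tau>. M * w (t - \<tau>))"
    using lborel_integrable_real_affine[OF w(1), of "- 1" t] by auto
  then show ?thesis
    unfolding set_integrable_def
  proof (rule Bochner_Integration.integrable_bound)
    show "AE \<tau> in lborel. norm (indicator {a..t} \<tau> *\<^sub>R (RL_kernel \<delta> t \<tau> * f \<tau>))
        \<le> norm (M * w (t - \<tau>))"
    proof (rule AE_I2)
      fix \<tau>
      show "norm (indicator {a..t} \<tau> *\<^sub>R (RL_kernel \<delta> t \<tau> * f \<tau>)) \<le> norm (M * w (t - \<tau>))"
      proof (cases "\<tau> \<in> {a..t}")
        case True
        then have "\<bar>RL_kernel \<delta> t \<tau>\<bar> * \<bar>f \<tau>\<bar> \<le> w (t - \<tau>) * M"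
          using w(2,3) M[of \<tau>] t by (intro mult_mono) auto
        then show ?thesis
          using True M0 w(2) by (simp add: abs_mult mult.commute)
      qed auto
    qed
  qed (use left_measurable[OF f t] in simp)
qed

lemma left_continuous:
  assumes f: "continuous_on {a..b} f"
  shows "continuous_on {a..b} (left_RL_integral \<delta> a f)"
proof -
  obtain w :: "real \<Rightarrow> real" where w: "integrable lborel w" "\<And>u. 0 \<le> w u"
    "\<And>s t. a \<le> t \<Longrightarrow> t \<le> s \<Longrightarrow> s \<le> b \<Longrightarrow> \<bar>RL_kernel \<delta> s t\<bar> \<le> w (s - t)"
    using kernel_majorant by metis
  obtain M where M: "0 \<le> M" "\<And>\<tau>. \<tau> \<in> {a..b} \<Longrightarrow> \<bar>f \<tau>\<bar> \<le> M"
    using continuous_on_Icc_bounded[OF f] by blast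
  (* After the substitution u = t - \<tau> the singularity sits at u = 0 for every t, so a single
     function dominates all integrands. *)
  define H where "H t u = indicator {0..t - a} u *\<^sub>R (RL_kernel \<delta> t (t - u) * f (t - u))" for t u
  have H: "H t u = (\<lambda>\<tau>. indicator {a..t} \<tau> *\<^sub>R (RL_kernel \<delta> t \<tau> * f \<tau>)) (t + (- 1) * u)" for t u
    by (auto simp: H_def indicator_def)
  have int: "left_RL_integral \<delta> a f t = integral\<^sup>L lborel (H t)" for t
    unfolding left_RL_integral_kernel set_lebesgue_integral_def
    by (subst lborel_integral_real_affine[where c = "- 1" and t = t])
      (auto simp: H_def indicator_def intro!: Bochner_Integration.integral_cong)
  have meas: "H t \<in> borel_measurable lborel" if "t \<in> {a..b}" for t
  proof -
    have [measurable]: "(\<lambda>\<tau>. indicator {a..t} \<tau> *\<^sub>R (RL_kernel \<delta> t \<tau> * f \<tau>)) \<in> borel_measurable borel"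
      using left_measurable[OF set_borel_measurable_continuous_Icc[OF f] that] .
    show ?thesis
      unfolding H[abs_def] by measurable
  qed
  have bound: "norm (H t u) \<le> M * w u" if "t \<in> {a..b}" for t u
  proof (cases "u \<in> {0..t - a}")
    case True
    then have "\<bar>RL_kernel \<delta> t (t - u)\<bar> * \<bar>f (t - u)\<bar> \<le> w u * M"
      using w(2) w(3)[of "t - u" t] M(2)[of "t - u"] that by (intro mult_mono) auto
    then show ?thesis
      using True by (simp add: H_def abs_mult mult.commute)
  qed (use M w(2) in \<open>auto simp: H_def\<close>)
  \<comment> \<open>The two excluded points are the singularity \<open>u = 0\<close> and the point
    \<open>u = t - a\<close>, where the indicator jumps. Both are null sets.\<close>
  have lim: "(\<lambda>n. H (X n) u) \<longlonglongrightarrow> H t u"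
    if X: "\<And>n. X n \<in> {a..b}" "X \<longlonglongrightarrow> t" and t: "t \<in> {a..b}" and u: "u \<noteq> 0" "u \<noteq> t - a" for X t u
  proof -
    consider "u < 0" | "t - a < u" | "0 < u" "u < t - a" using u by linarith
    then show ?thesis
    proof cases
      case 1
      then show ?thesis by (simp add: H_def)
    next
      case 2
      have "(\<lambda>n. X n - a) \<longlonglongrightarrow> t - a"
        by (intro tendsto_intros X)
      then have "\<forall>\<^sub>F n in sequentially. X n - a < u"
        using 2 order_tendstoD(2) by blast
      then have "\<forall>\<^sub>F n in sequentially. H (X n) u = H t u"
        by eventually_elim (use 2 in \<open>auto simp: H_def\<close>)
      then show ?thesis
        by (simp add: tendsto_eventually)
    next
      case 3
      \<comment> \<open>For fixed \<open>u > 0\<close> the points \<open>(s, s - u)\<close> keep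
        their distance from the diagonal.\<close>
      have c: "continuous_on {a + u..b} (\<lambda>s. RL_kernel \<delta> s (s - u) * f (s - u))"
        using 3 by (intro continuous_intros continuous_on_compose2[OF f]
            continuous_on_compose2[OF kernel_continuous, of _ "\<lambda>s. (s, s - u)", simplified]) auto
      have "(\<lambda>n. X n - a) \<longlonglongrightarrow> t - a"
        by (intro tendsto_intros X)
      then have ev: "\<forall>\<^sub>F n in sequentially. u < X n - a"
        using 3 order_tendstoD(1) by blast
      then have "\<forall>\<^sub>F n in sequentially. X n \<in> {a + u..b}"
        by eventually_elim (use X(1) in \<open>auto simp: less_imp_le algebra_simps\<close>)
      then have "(\<lambda>n. RL_kernel \<delta> (X n) (X n - u) * f (X n - u))
          \<longlonglongrightarrow> RL_kernel \<delta> t (t - u) * f (t - u)"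
        using 3 t by (intro continuous_on_tendsto_compose[OF c X(2)]) auto
      moreover have "\<forall>\<^sub>F n in sequentially. RL_kernel \<delta> (X n) (X n - u) * f (X n - u) = H (X n) u"
        using ev by eventually_elim (use 3 in \<open>auto simp: H_def\<close>)
      ultimately show ?thesis
        using 3 by (auto simp: H_def[of t] elim!: Lim_transform_eventually)
    qed
  qed
  show ?thesis
  proof (rule continuous_on_sequentiallyI)
    fix X t
    assume X: "\<forall>n. X n \<in> {a..b}" "t \<in> {a..b}" "X \<longlonglongrightarrow> t"
    have AE: "AE u in lborel. (\<lambda>n. H (X n) u) \<longlonglongrightarrow> H t u"
      using AE_lborel_singleton[of 0] AE_lborel_singleton[of "t - a"]
      by eventually_elim (use X lim in auto)
    have "(\<lambda>n. integral\<^sup>L lborel (H (X n))) \<longlonglongrightarrow> integral\<^sup>L lborel (H t)"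
      by (rule integral_dominated_convergence[where w = "\<lambda>u. M * w u"])
        (use X AE bound meas w(1) in \<open>auto\<close>)
    then show "(\<lambda>n. left_RL_integral \<delta> a f (X n)) \<longlonglongrightarrow> left_RL_integral \<delta> a f t"
      by (simp add: int)
  qed
qed

lemma right_integrable:
  assumes f: "continuous_on {a..b} f" and t: "t \<in> {a..b}"
  shows "set_integrable lborel {t..b} (\<lambda>\<tau>. RL_kernel \<delta> \<tau> t * f \<tau>)"
proof -
  interpret R: variable_order "- b" "- a" "\<lambda>s u. \<delta> (- u) (- s)"
    by (rule reflect)
  have g: "continuous_on {- b..- a} (\<lambda>s. f (- s))"
    by (intro continuous_on_compose2[OF f] continuous_intros) auto
  obtain M where M: "\<And>\<tau>. \<tau> \<in> {- b..- a} \<Longrightarrow> \<bar>f (- \<tau>)\<bar> \<le> M"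
    using continuous_on_Icc_bounded[OF g] by blast
  have "integrable lborel (\<lambda>\<tau>. indicator {- b..- t} \<tau> *\<^sub>R
      (RL_kernel (\<lambda>s u. \<delta> (- u) (- s)) (- t) \<tau> * f (- \<tau>)))"
    using R.left_integrable[OF set_borel_measurable_continuous_Icc[OF g] M, of "- t"] t
    by (simp add: set_integrable_def)
  from lborel_integrable_real_affine[OF this, of "- 1" 0]
  have "integrable lborel (\<lambda>\<tau>. indicator {- b..- t} (- \<tau>) *\<^sub>R
      (RL_kernel (\<lambda>s u. \<delta> (- u) (- s)) (- t) (- \<tau>) * f \<tau>))"
    by simp
  also have "(\<lambda>\<tau>. indicator {- b..- t} (- \<tau>) *\<^sub>R
      (RL_kernel (\<lambda>s u. \<delta> (- u) (- s)) (- t) (- \<tau>) * f \<tau>))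
    = (\<lambda>\<tau>. indicator {t..b} \<tau> *\<^sub>R (RL_kernel \<delta> \<tau> t * f \<tau>))"
    by (auto simp: fun_eq_iff indicator_def RL_kernel_def)
  finally show ?thesis
    by (simp add: set_integrable_def)
qed

lemma right_continuous:
  assumes f: "continuous_on {a..b} f"
  shows "continuous_on {a..b} (right_RL_integral \<delta> b f)"
proof -
  interpret R: variable_order "- b" "- a" "\<lambda>s u. \<delta> (- u) (- s)"
    by (rule reflect)
  have "continuous_on {- b..- a} (\<lambda>s. f (- s))"
    by (intro continuous_on_compose2[OF f] continuous_intros) auto
  from R.left_continuous[OF this] show ?thesis
    unfolding right_RL_integral_reflect[abs_def]
    by (rule continuous_on_compose2) (auto intro!: continuous_intros)
qed

text \<open>By Fubini both sides are the integral of
  \<open>RL_kernel \<delta> s t * f s * g t\<close> over the triangle \<open>t < s\<close>. The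
  diagonal contributes nothing, as the kernel is 0 there.\<close>

lemma integration_by_parts:
  assumes f: "set_borel_measurable borel {a..b} f" and M: "\<And>\<tau>. \<tau> \<in> {a..b} \<Longrightarrow> \<bar>f \<tau>\<bar> \<le> M"
    and g: "set_borel_measurable borel {a..b} g" and N: "\<And>\<tau>. \<tau> \<in> {a..b} \<Longrightarrow> \<bar>g \<tau>\<bar> \<le> N"
  shows "(LBINT s:{a..b}. f s * left_RL_integral \<delta> a g s)
       = (LBINT t:{a..b}. g t * right_RL_integral \<delta> b f t)"
proof -
  obtain w :: "real \<Rightarrow> real" where w: "integrable lborel w" "\<And>u. 0 \<le> w u"
    "\<And>s t. a \<le> t \<Longrightarrow> t \<le> s \<Longrightarrow> s \<le> b \<Longrightarrow> \<bar>RL_kernel \<delta> s t\<bar> \<le> w (s - t)"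
    using kernel_majorant by metis
  let ?S = "{(s, t). a \<le> t \<and> t < s \<and> s \<le> b}"
  let ?f = "\<lambda>s. indicator {a..b} s *\<^sub>R f s" and ?g = "\<lambda>s. indicator {a..b} s *\<^sub>R g s"
  have mf: "?f \<in> borel_measurable borel" "?g \<in> borel_measurable borel"
    using f g by (simp_all add: set_borel_measurable_def)
  have [measurable]: "w \<in> borel_measurable borel"
    using w(1) by (simp add: borel_measurable_integrable flip: measurable_lborel1)
  have "Measurable.pred (borel \<Otimes>\<^sub>M borel) (\<lambda>p::real \<times> real. a \<le> snd p \<and> snd p < fst p \<and> fst p \<le> b)"
    by measurable
  moreover have "?S = {p. a \<le> snd p \<and> snd p < fst p \<and> fst p \<le> b}"
    by auto
  ultimately have "?S \<in> sets borel"
    by (simp only: borel_prod pred_def space_borel UNIV_I simp_thms)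
  then have "(\<lambda>p. indicator ?S p *\<^sub>R RL_kernel \<delta> (fst p) (snd p)) \<in> borel_measurable borel"
    using kernel_continuous
    by (intro borel_measurable_continuous_on_indicator) (auto simp: case_prod_beta)
  then have mK: "(\<lambda>p. indicator ?S p *\<^sub>R RL_kernel \<delta> (fst p) (snd p))
      \<in> borel_measurable (borel \<Otimes>\<^sub>M borel)"
    by (simp add: borel_prod)
  define H where "H s t = (indicator ?S (s, t) *\<^sub>R RL_kernel \<delta> s t) * ?f s * ?g t" for s t
  have ms: "borel_measurable (lborel \<Otimes>\<^sub>M lborel)
      = (borel_measurable (borel \<Otimes>\<^sub>M borel) :: (real \<times> real \<Rightarrow> real) set)"
    by (intro measurable_cong_sets sets_pair_measure_cong) auto
  have H_meas: "case_prod H \<in> borel_measurable (lborel \<Otimes>\<^sub>M lborel)"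
  proof -
    have "(\<lambda>p. (indicator ?S p *\<^sub>R RL_kernel \<delta> (fst p) (snd p)) * ?f (fst p) * ?g (snd p))
        \<in> borel_measurable (borel \<Otimes>\<^sub>M borel)"
      by (intro borel_measurable_times mK measurable_compose[OF measurable_fst mf(1)]
          measurable_compose[OF measurable_snd mf(2)])
    moreover have "case_prod H
        = (\<lambda>p. (indicator ?S p *\<^sub>R RL_kernel \<delta> (fst p) (snd p)) * ?f (fst p) * ?g (snd p))"
      by (rule ext) (simp only: H_def case_prod_beta fst_conv snd_conv prod.collapse)
    ultimately show ?thesis
      by (simp only: ms)
  qed
  have inner: "integrable lborel (\<lambda>t. w (s - t))" "(\<integral>t. w (s - t) \<partial>lborel) = integral\<^sup>L lborel w" for s
    using lborel_integrable_real_affine[OF w(1), of "- 1" s]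
      lborel_integral_real_affine[of "- 1" w s] by auto
  \<comment> \<open>The integral over \<open>t\<close> is the same constant for every
    \<open>s\<close>, so only the indicator of [a,b] is left to integrate. The absolute values avoid
    a sign condition on \<open>M\<close> and \<open>N\<close>, which may be negative when [a,b] is
    empty.\<close>
  have Z: "integrable (lborel \<Otimes>\<^sub>M lborel) (\<lambda>(s, t). \<bar>M\<bar> * \<bar>N\<bar> * indicator {a..b} s * w (s - t))"
  proof (rule lborel_pair.Fubini_integrable)
    have "(\<lambda>p. \<bar>M\<bar> * \<bar>N\<bar> * indicator {a..b} (fst p) * w (fst p - snd p))
        \<in> borel_measurable (borel \<Otimes>\<^sub>M borel)"
      by measurable
    then show "(\<lambda>(s, t). \<bar>M\<bar> * \<bar>N\<bar> * indicator {a..b} s * w (s - t))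
        \<in> borel_measurable (lborel \<Otimes>\<^sub>M lborel)"
      by (simp add: case_prod_beta ms)
    have "integrable lborel (\<lambda>s. indicator {a..b} s *\<^sub>R (\<bar>M\<bar> * \<bar>N\<bar> * integral\<^sup>L lborel w))"
      using borel_integrable_atLeastAtMost'[of a b "\<lambda>_. \<bar>M\<bar> * \<bar>N\<bar> * integral\<^sup>L lborel w"]
      by (simp add: set_integrable_def)
    then show "integrable lborel (\<lambda>s. \<integral>t. norm (case (s, t) of
        (s, t) \<Rightarrow> \<bar>M\<bar> * \<bar>N\<bar> * indicator {a..b} s * w (s - t)) \<partial>lborel)"
      using w(2) inner by (simp add: abs_mult mult_ac)
  qed (use inner in auto)
  have "integrable (lborel \<Otimes>\<^sub>M lborel) (case_prod H)"
  proof (rule Bochner_Integration.integrable_bound[OF Z H_meas], rule AE_I2)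
    fix p :: "real \<times> real"
    obtain s t where p: "p = (s, t)" by (cases p)
    have "norm (H s t) \<le> \<bar>M\<bar> * \<bar>N\<bar> * indicator {a..b} s * w (s - t)"
    proof (cases "(s, t) \<in> ?S")
      case True
      have "\<bar>RL_kernel \<delta> s t\<bar> * \<bar>f s\<bar> * \<bar>g t\<bar> \<le> w (s - t) * \<bar>M\<bar> * \<bar>N\<bar>"
        using True w(2) w(3)[of t s] M[of s] N[of t] by (intro mult_mono) auto
      then show ?thesis
        using True by (simp add: H_def abs_mult mult_ac)
    qed (use w(2) in \<open>auto simp: H_def\<close>)
    also have "\<dots> = norm (\<bar>M\<bar> * \<bar>N\<bar> * indicator {a..b} s * w (s - t))"
      using w(2) by (simp add: abs_mult)
    finally show "norm (case_prod H p)
        \<le> norm (case p of (s, t) \<Rightarrow> \<bar>M\<bar> * \<bar>N\<bar> * indicator {a..b} s * w (s - t))"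
      by (simp add: p)
  qed
  from lborel_pair.Fubini_integral[OF this]
  have swap: "(\<integral>t. (\<integral>s. H s t \<partial>lborel) \<partial>lborel) = (\<integral>s. (\<integral>t. H s t \<partial>lborel) \<partial>lborel)" .
  have 1: "(\<integral>t. H s t \<partial>lborel) = indicator {a..b} s *\<^sub>R (f s * left_RL_integral \<delta> a g s)" for s
  proof -
    have "H s t = (indicator {a..b} s * f s) * (indicator {a..s} t *\<^sub>R (RL_kernel \<delta> s t * g t))" for t
      by (cases "t = s") (auto simp: H_def indicator_def)
    then show ?thesis
      by (simp add: left_RL_integral_kernel set_lebesgue_integral_def)
  qed
  have 2: "(\<integral>s. H s t \<partial>lborel) = indicator {a..b} t *\<^sub>R (g t * right_RL_integral \<delta> b f t)" for t
  proof -
    have "H s t = (indicator {a..b} t * g t) * (indicator {t..b} s *\<^sub>R (RL_kernel \<delta> s t * f s))" for s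
      by (cases "t = s") (auto simp: H_def indicator_def)
    then show ?thesis
      by (simp add: right_RL_integral_kernel set_lebesgue_integral_def)
  qed
  show ?thesis
    using swap by (simp add: 1 2 set_lebesgue_integral_def)
qed

end

section \<open>Linearity and truncation\<close>

context variable_order
begin

lemma left_affine:
  assumes f: "continuous_on {a..b} f" and g: "continuous_on {a..b} g" and t: "t \<in> {a..b}"
  shows "left_RL_integral \<delta> a (\<lambda>\<tau>. f \<tau> + e * g \<tau>) t
    = left_RL_integral \<delta> a f t + e * left_RL_integral \<delta> a g t"
proof -
  have int: "set_integrable lborel {a..t} (\<lambda>\<tau>. RL_kernel \<delta> t \<tau> * h \<tau>)"
    if h: "continuous_on {a..b} h" for h
    using left_integrable[OF set_borel_measurable_continuous_Icc[OF h] _ t]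
      continuous_on_Icc_bounded[OF h] by metis
  show ?thesis
    unfolding left_RL_integral_kernel distrib_left mult.left_commute[of _ e]
    using int[OF f] int[OF g] by (simp add: set_integral_add)
qed

lemma right_affine:
  assumes f: "continuous_on {a..b} f" and g: "continuous_on {a..b} g" and t: "t \<in> {a..b}"
  shows "right_RL_integral \<delta> b (\<lambda>\<tau>. f \<tau> + e * g \<tau>) t
    = right_RL_integral \<delta> b f t + e * right_RL_integral \<delta> b g t"
  unfolding right_RL_integral_kernel distrib_left mult.left_commute[of _ e]
  using right_integrable[OF f t] right_integrable[OF g t] by (simp add: set_integral_add)

text \<open>Past the cut, the missing piece is the left integral based at \<open>c\<close>. This is
  the origin of the difference of two left integrals in the conditions on [T,b].\<close>

lemma left_truncated:
  assumes f: "continuous_on {a..b} f" and c: "a \<le> c" "c \<le> t" "t \<le> b"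
  shows "left_RL_integral \<delta> a (\<lambda>\<tau>. indicator {a..c} \<tau> * f \<tau>) t
    = left_RL_integral \<delta> a f t - left_RL_integral \<delta> c f t"
proof -
  have int: "set_integrable lborel {a..t} (\<lambda>\<tau>. RL_kernel \<delta> t \<tau> * f \<tau>)"
    using left_integrable[OF set_borel_measurable_continuous_Icc[OF f], of _ t]
      continuous_on_Icc_bounded[OF f] c by (metis atLeastAtMost_iff order_trans)
  have "(LBINT \<tau>:{a..c} \<union> {c..t}. RL_kernel \<delta> t \<tau> * f \<tau>)
      = (LBINT \<tau>:{a..c}. RL_kernel \<delta> t \<tau> * f \<tau>) + (LBINT \<tau>:{c..t}. RL_kernel \<delta> t \<tau> * f \<tau>)"
  proof (rule set_integral_Un_AE)
    show "AE \<tau> in lborel. \<not> (\<tau> \<in> {a..c} \<and> \<tau> \<in> {c..t})"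
      using AE_lborel_singleton[of c] by eventually_elim auto
  qed (use c in \<open>auto intro: set_integrable_subset[OF int]\<close>)
  moreover have "{a..c} \<union> {c..t} = {a..t}"
    using c by auto
  moreover have "left_RL_integral \<delta> a (\<lambda>\<tau>. indicator {a..c} \<tau> * f \<tau>) t
      = (LBINT \<tau>:{a..c}. RL_kernel \<delta> t \<tau> * f \<tau>)"
    unfolding left_RL_integral_kernel set_lebesgue_integral_def
    using c by (intro Bochner_Integration.integral_cong) (auto simp: indicator_def)
  ultimately show ?thesis
    by (simp add: left_RL_integral_kernel)
qed

text \<open>The outer integral ends at \<open>c\<close> while the right operator reaches to
  \<open>b\<close>. Extending \<open>f\<close> by 0 makes both intervals [a,b], at the price of a
  jump at \<open>c\<close>, which the bounded measurable version tolerates.\<close>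

lemma integration_by_parts_truncated:
  assumes f: "continuous_on {a..b} f" and g: "continuous_on {a..b} g" and c: "a \<le> c" "c \<le> b"
  shows "(LBINT s:{a..c}. f s * right_RL_integral \<delta> b g s)
    = (LBINT t:{a..b}. g t * left_RL_integral \<delta> a (\<lambda>\<tau>. indicator {a..c} \<tau> * f \<tau>) t)"
proof -
  obtain M where M: "0 \<le> M" "\<And>\<tau>. \<tau> \<in> {a..b} \<Longrightarrow> \<bar>f \<tau>\<bar> \<le> M"
    using continuous_on_Icc_bounded[OF f] by blast
  obtain N where N: "\<And>\<tau>. \<tau> \<in> {a..b} \<Longrightarrow> \<bar>g \<tau>\<bar> \<le> N"
    using continuous_on_Icc_bounded[OF g] by blast
  have "(\<lambda>\<tau>. indicator {a..b} \<tau> *\<^sub>R (indicator {a..c} \<tau> * f \<tau>)) = (\<lambda>\<tau>. indicator {a..c} \<tau> *\<^sub>R f \<tau>)"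
    using c by (auto simp: indicator_def fun_eq_iff)
  then have fm: "set_borel_measurable borel {a..b} (\<lambda>\<tau>. indicator {a..c} \<tau> * f \<tau>)"
    using set_borel_measurable_continuous_Icc[OF continuous_on_subset[OF f, of "{a..c}"]] c
    by (auto simp: set_borel_measurable_def)
  have fM: "\<bar>indicator {a..c} \<tau> * f \<tau>\<bar> \<le> M" if "\<tau> \<in> {a..b}" for \<tau>
    using M that by (auto simp: indicator_def)
  have "(LBINT t:{a..b}. g t * left_RL_integral \<delta> a (\<lambda>\<tau>. indicator {a..c} \<tau> * f \<tau>) t)
      = (LBINT s:{a..b}. indicator {a..c} s * f s * right_RL_integral \<delta> b g s)"
    by (rule integration_by_parts[OF set_borel_measurable_continuous_Icc[OF g] N fm fM])
  also have "\<dots> = (LBINT s:{a..c}. f s * right_RL_integral \<delta> b g s)"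
    unfolding set_lebesgue_integral_def
    using c by (intro Bochner_Integration.integral_cong) (auto simp: indicator_def)
  finally show ?thesis by simp
qed

end

section \<open>Tools from the calculus of variations\<close>

lemma deriv_on_eqI:
  assumes "(f has_vector_derivative f') (at t within {c..d})" "c < d" "t \<in> {c..d}"
  shows "deriv_on {c..d} f t = f'"
  using vector_derivative_within_cbox[of c d t f f'] assms by (simp add: deriv_on_def)

text \<open>Test functions are velocities, so continuity is all they need. They live on the whole
  line and vanish off the open interval, so that one supported in a piece of [a,b] is admissible on
  all of it. The conclusion reaches the end points by continuity, which is what the transversality
  conditions rely on.\<close>

lemma fundamental_lemma_calculus_of_variations:
  fixes W :: "real \<Rightarrow> real"
  assumes "c < d" and W: "continuous_on {c..d} W"
    and null: "\<And>g. continuous_on UNIV g \<Longrightarrow> (\<And>t. t \<notin> {c<..<d} \<Longrightarrow> g t = 0) \<Longrightarrow>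
      integral {c..d} (\<lambda>t. g t * W t) = 0"
    and t: "t \<in> {c..d}"
  shows "W t = 0"
proof -
  (* g = (t - c) (d - t) W on [c,d]; clamping the argument of W makes g continuous on the line *)
  define g where "g t = max 0 ((t - c) * (d - t)) * W (max c (min d t))" for t
  have "continuous_on UNIV g"
    unfolding g_def using \<open>c < d\<close>
    by (intro continuous_intros continuous_on_compose2[OF W]) auto
  moreover have "g t = 0" if "t \<notin> {c<..<d}" for t
  proof -
    have "(t - c) * (d - t) \<le> 0"
      using that \<open>c < d\<close> by (auto simp: mult_le_0_iff)
    then show ?thesis by (simp add: g_def)
  qed
  ultimately have "integral {c..d} (\<lambda>t. g t * W t) = 0"
    by (rule null)
  also have "integral {c..d} (\<lambda>t. g t * W t) = integral {c..d} (\<lambda>t. (t - c) * (d - t) * (W t)\<^sup>2)"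
    by (intro integral_cong) (auto simp: g_def power2_eq_square max_def min_def)
  finally have 0: "\<forall>t\<in>{c..d}. (t - c) * (d - t) * (W t)\<^sup>2 = 0"
    using \<open>c < d\<close> W by (subst (asm) integral_eq_0_iff) (auto intro!: continuous_intros)
  have "W s = 0" if "s \<in> {c<..<d}" for s
    using 0[rule_format, of s] that by auto
  then show ?thesis
    using continuous_constant_on_closure[of "{c<..<d}" W 0 t] W \<open>c < d\<close> t by auto
qed

lemma integral_primitive_swap:
  fixes q g :: "real \<Rightarrow> real"
  assumes q: "continuous_on {c..d} q" and g: "continuous_on {c..d} g" and "c \<le> d"
  shows "integral {c..d} (\<lambda>t. q t * integral {c..t} g)
    = integral {c..d} (\<lambda>t. g t * (integral {c..d} q - integral {c..t} q))"
proof -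
  \<comment> \<open>The first factor vanishes at \<open>d\<close> and the second at
    \<open>c\<close>, so this product has no boundary terms.\<close>
  let ?F = "\<lambda>t. (integral {c..d} q - integral {c..t} q) * integral {c..t} g"
  note ic = indefinite_integral_continuous_1[OF integrable_continuous_real]
  have "((\<lambda>t. g t * (integral {c..d} q - integral {c..t} q) - q t * integral {c..t} g)
      has_integral (?F d - ?F c)) {c..d}"
  proof (rule fundamental_theorem_of_calculus[OF \<open>c \<le> d\<close>])
    fix t assume t: "t \<in> {c..d}"
    show "(?F has_vector_derivative
        (g t * (integral {c..d} q - integral {c..t} q) - q t * integral {c..t} g)) (at t within {c..d})"
      unfolding has_real_derivative_iff_has_vector_derivative[symmetric]
      by (rule derivative_eq_intros integral_has_real_derivative[OF q t]
          integral_has_real_derivative[OF g t] refl)+ (simp add: algebra_simps)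
  qed
  moreover have "(\<lambda>t. g t * (integral {c..d} q - integral {c..t} q)) integrable_on {c..d}"
    by (intro integrable_continuous_real continuous_intros g ic[OF q])
  moreover have "(\<lambda>t. q t * integral {c..t} g) integrable_on {c..d}"
    by (intro integrable_continuous_real continuous_intros q ic[OF g])
  ultimately show ?thesis
    using integral_diff by (fastforce dest: integral_unique)
qed

text \<open>Along a curve that stays in \<open>{a..b} \<times> UNIV\<close> the chain rule is available even at points on the
  boundary of that strip.\<close>

lemma has_derivative_within_comp_curve:
  fixes f :: "'a::real_normed_vector \<Rightarrow> real" and c :: "real \<Rightarrow> 'a"
  assumes f: "(f has_derivative f') (at (c e) within S)"
    and c: "(c has_vector_derivative c') (at e within U)" and S: "\<And>s. s \<in> U \<Longrightarrow> c s \<in> S"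
  shows "((\<lambda>s. f (c s)) has_field_derivative f' c') (at e within U)"
proof -
  have "((\<lambda>s. f (c s)) has_derivative (\<lambda>r. f' (r *\<^sub>R c'))) (at e within U)"
    using has_derivative_in_compose[of c _ e U f f'] has_derivative_subset[OF f, of "c ` U"] S c
    by (auto simp: has_vector_derivative_def image_subset_iff)
  moreover have "(\<lambda>r. f' (r *\<^sub>R c')) = (*) (f' c')"
    using linear_scale[OF has_derivative_linear[OF f]] by (simp add: fun_eq_iff mult.commute)
  ultimately show ?thesis
    by (simp add: has_field_derivative_def)
qed

text \<open>The curves used here keep \<open>t\<close> fixed, so they stay in the strip for every
  \<open>e\<close> and the derivative in \<open>e\<close> is two-sided even for \<open>t\<close> at
  an end point. Moving along one coordinate at a time identifies \<open>L'\<close> on the unit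
  vectors with the partial derivatives.\<close>

lemma Lagrangian_chain_rule:
  assumes L: "(\<lambda>(t, y, v). L t y v) differentiable_on ({a..b} \<times> UNIV)" and t: "t \<in> {a..b}"
  shows "((\<lambda>e. L t (y + e * h) (v + e * k)) has_field_derivative
    D2L L t (y + e * h) (v + e * k) * h + D3L L t (y + e * h) (v + e * k) * k) (at e)"
proof -
  define Y V where "Y = y + e * h" and "V = v + e * k"
  obtain L' where L': "((\<lambda>(t, y, v). L t y v) has_derivative L') (at (t, Y, V) within {a..b} \<times> UNIV)"
    using L[unfolded differentiable_on_def, rule_format, of "(t, Y, V)"] t
    unfolding differentiable_def by blast
  note chain = has_derivative_within_comp_curve[of "\<lambda>(t, y, v). L t y v" L' _ _ "{a..b} \<times> UNIV" _ UNIV]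
  have "((\<lambda>z. (t, z, V)) has_vector_derivative (0, 1, 0)) (at Y)"
    by (intro has_vector_derivative_Pair has_vector_derivative_const has_vector_derivative_id)
  from chain[OF _ this] have "((\<lambda>z. L t z V) has_field_derivative L' (0, 1, 0)) (at Y)"
    using L' t by auto
  then have 2: "D2L L t Y V = L' (0, 1, 0)"
    unfolding D2L_def by (rule DERIV_imp_deriv)
  have "((\<lambda>z. (t, Y, z)) has_vector_derivative (0, 0, 1)) (at V)"
    by (intro has_vector_derivative_Pair has_vector_derivative_const has_vector_derivative_id)
  from chain[OF _ this] have "((\<lambda>z. L t Y z) has_field_derivative L' (0, 0, 1)) (at V)"
    using L' t by auto
  then have 3: "D3L L t Y V = L' (0, 0, 1)"
    unfolding D3L_def by (rule DERIV_imp_deriv)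
  have "((\<lambda>e. (t, y + e * h, v + e * k)) has_vector_derivative (0, h, k)) (at e)"
    by (intro has_vector_derivative_Pair has_vector_derivative_const)
      (auto intro!: derivative_eq_intros simp flip: has_real_derivative_iff_has_vector_derivative)
  from chain[OF _ this]
  have "((\<lambda>e. L t (y + e * h) (v + e * k)) has_field_derivative L' (0, h, k)) (at e)"
    using L' t by (auto simp: Y_def V_def)
  moreover have "L' (0, h, k) = L' (h *\<^sub>R (0, 1, 0) + k *\<^sub>R (0, 0, 1))"
    by simp
  then have "L' (0, h, k) = h * L' (0, 1, 0) + k * L' (0, 0, 1)"
    using has_derivative_linear[OF L'] by (simp only: linear_add linear_scale real_scaleR_def)
  ultimately show ?thesis
    by (simp add: 2[unfolded Y_def V_def] 3[unfolded Y_def V_def] mult.commute)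
qed

text \<open>The curve in the time direction runs over \<open>{a..b}\<close> only, in agreement with
  \<open>D1phi\<close>, which is one-sided at the end points.\<close>

lemma terminal_cost_derivative:
  assumes \<phi>: "C1_terminal_cost a b \<phi>" and t: "t \<in> {a..b}" and "a < b"
  obtains \<phi>' where "((\<lambda>(t, y). \<phi> t y) has_derivative \<phi>') (at (t, y) within {a..b} \<times> UNIV)"
    "\<And>r s. \<phi>' (r, s) = D1phi a b \<phi> t y * r + D2phi \<phi> t y * s"
proof -
  obtain \<phi>' where d: "((\<lambda>(t, y). \<phi> t y) has_derivative \<phi>') (at (t, y) within {a..b} \<times> UNIV)"
    using \<phi>[unfolded C1_terminal_cost_def differentiable_on_def, THEN conjunct1, rule_format,
        of "(t, y)"] t
    unfolding differentiable_def by blast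
  have "((\<lambda>s. (s, y)) has_vector_derivative (1, 0)) (at t within {a..b})"
    by (intro has_vector_derivative_Pair has_vector_derivative_const has_vector_derivative_id)
  from has_derivative_within_comp_curve[OF _ this, of "\<lambda>(t, y). \<phi> t y" \<phi>' "{a..b} \<times> UNIV"]
  have "((\<lambda>s. \<phi> s y) has_field_derivative \<phi>' (1, 0)) (at t within {a..b})"
    using d by auto
  then have 1: "D1phi a b \<phi> t y = \<phi>' (1, 0)"
    unfolding D1phi_def using t \<open>a < b\<close>
    by (intro deriv_on_eqI) (auto simp: has_real_derivative_iff_has_vector_derivative)
  have "((\<lambda>z. (t, z)) has_vector_derivative (0, 1)) (at y)"
    by (intro has_vector_derivative_Pair has_vector_derivative_const has_vector_derivative_id)
  from has_derivative_within_comp_curve[OF _ this, of "\<lambda>(t, y). \<phi> t y" \<phi>' "{a..b} \<times> UNIV"]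
  have "((\<lambda>z. \<phi> t z) has_field_derivative \<phi>' (0, 1)) (at y)"
    using d t by auto
  then have 2: "D2phi \<phi> t y = \<phi>' (0, 1)"
    unfolding D2phi_def by (rule DERIV_imp_deriv)
  have "\<phi>' (r, s) = D1phi a b \<phi> t y * r + D2phi \<phi> t y * s" for r s
  proof -
    have "\<phi>' (r, s) = \<phi>' (r *\<^sub>R (1, 0) + s *\<^sub>R (0, 1))"
      by simp
    also have "\<dots> = r * \<phi>' (1, 0) + s * \<phi>' (0, 1)"
      using has_derivative_linear[OF d] by (simp only: linear_add linear_scale real_scaleR_def)
    finally show ?thesis by (simp add: 1 2 mult.commute)
  qed
  with d that show ?thesis by blast
qed

lemma continuous_on_compose_strip:
  fixes F :: "real \<Rightarrow> real \<Rightarrow> real \<Rightarrow> real"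
  assumes F: "continuous_on (S \<times> UNIV) (\<lambda>(t, y, v). F t y v)"
    and "continuous_on A f" "continuous_on A g" "continuous_on A h"
    and "\<And>s. s \<in> A \<Longrightarrow> f s \<in> S"
  shows "continuous_on A (\<lambda>s. F (f s) (g s) (h s))"
proof -
  have "continuous_on A (\<lambda>s. (f s, g s, h s))"
    by (intro continuous_intros assms)
  from continuous_on_compose2[OF F this] show ?thesis
    using assms(5) by (simp add: image_subset_iff)
qed

text \<open>The definitions use Lebesgue integrals, while the fundamental theorem and the Leibniz
  rule are applied to gauge integrals; continuous integrands connect the two.\<close>

lemma LBINT_eq_integral:
  fixes f :: "real \<Rightarrow> real"
  assumes "continuous_on {c..d} f"
  shows "(LBINT t:{c..d}. f t) = integral {c..d} f"
  by (rule set_borel_integral_eq_integral(2)[OF borel_integrable_atLeastAtMost'[OF assms]])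

lemma C1_on_interval_has_vector_derivative:
  assumes "C1_on_interval a b x" "t \<in> {a..b}"
  shows "(x has_vector_derivative deriv_on {a..b} x t) (at t within {a..b})"
  using assms unfolding C1_on_interval_def differentiable_on_def deriv_on_def
  by (simp add: vector_derivative_works)

section \<open>First variation of a local minimizer\<close>

locale combined_order = \<alpha>: variable_order a b \<alpha> + \<beta>: variable_order a b \<beta> for a b \<alpha> \<beta> +
  fixes \<gamma>\<^sub>1 \<gamma>\<^sub>2 :: real
  assumes ab: "a < b"
begin

text \<open>This is the combined Caputo derivative as a linear operator on the velocity: applied to
  \<open>g\<close> it gives the derivative of the primitive of \<open>g\<close>.\<close>

definition Caputo_variation :: "(real \<Rightarrow> real) \<Rightarrow> real \<Rightarrow> real" where
  "Caputo_variation g t = \<gamma>\<^sub>1 * left_RL_integral \<alpha> a g t - \<gamma>\<^sub>2 * right_RL_integral \<beta> b g t"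

lemma combined_Caputo_eq:
  "combined_Caputo_deriv a b \<alpha> \<beta> \<gamma>\<^sub>1 \<gamma>\<^sub>2 x = Caputo_variation (deriv_on {a..b} x)"
  by (simp add: fun_eq_iff combined_Caputo_deriv_def Caputo_variation_def
      left_Caputo_deriv_def right_Caputo_deriv_def)

lemma Caputo_variation_continuous:
  "continuous_on {a..b} g \<Longrightarrow> continuous_on {a..b} (Caputo_variation g)"
  unfolding Caputo_variation_def[abs_def]
  by (intro continuous_intros \<alpha>.left_continuous \<beta>.right_continuous)

text \<open>The primitive of \<open>g\<close> vanishes at \<open>a\<close>, so the boundary
  condition survives, and the dependence on \<open>e\<close> is exactly affine. The perturbed
  velocity is computed on [a,b] only, which is all that both integrals see.\<close>

lemma
  assumes x: "C1_on_interval a b x" and g: "continuous_on {a..b} g"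
  shows perturbed_deriv: "t \<in> {a..b} \<Longrightarrow>
      deriv_on {a..b} (\<lambda>t. x t + e * integral {a..t} g) t = deriv_on {a..b} x t + e * g t"
    and perturbed_C1: "C1_on_interval a b (\<lambda>t. x t + e * integral {a..t} g)"
    and perturbed_Caputo: "t \<in> {a..b} \<Longrightarrow>
      combined_Caputo_deriv a b \<alpha> \<beta> \<gamma>\<^sub>1 \<gamma>\<^sub>2 (\<lambda>t. x t + e * integral {a..t} g) t
      = combined_Caputo_deriv a b \<alpha> \<beta> \<gamma>\<^sub>1 \<gamma>\<^sub>2 x t + e * Caputo_variation g t"
proof -
  let ?y = "\<lambda>t. x t + e * integral {a..t} g"
  have vd: "(?y has_vector_derivative deriv_on {a..b} x t + e * g t) (at t within {a..b})"
    if t: "t \<in> {a..b}" for t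
    by (intro has_vector_derivative_add has_vector_derivative_mult_right
        integral_has_vector_derivative C1_on_interval_has_vector_derivative assms t)
  then show deriv: "deriv_on {a..b} ?y t = deriv_on {a..b} x t + e * g t" if "t \<in> {a..b}" for t
    using deriv_on_eqI ab that by blast
  have c: "continuous_on {a..b} (deriv_on {a..b} x)"
    using x by (simp add: C1_on_interval_def)
  have "continuous_on {a..b} (deriv_on {a..b} ?y)"
    by (rule continuous_on_eq[where f = "\<lambda>t. deriv_on {a..b} x t + e * g t"])
      (auto simp: deriv intro!: continuous_intros c g)
  moreover have "?y differentiable_on {a..b}"
    using vd unfolding differentiable_on_def by (blast intro: differentiableI_vector)
  ultimately show "C1_on_interval a b ?y"
    by (simp add: C1_on_interval_def)
  assume t: "t \<in> {a..b}"
  have "left_RL_integral \<alpha> a (deriv_on {a..b} ?y) t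
      = left_RL_integral \<alpha> a (\<lambda>s. deriv_on {a..b} x s + e * g s) t"
    using t deriv by (intro left_RL_integral_cong) auto
  moreover have "right_RL_integral \<beta> b (deriv_on {a..b} ?y) t
      = right_RL_integral \<beta> b (\<lambda>s. deriv_on {a..b} x s + e * g s) t"
    using t deriv by (intro right_RL_integral_cong) auto
  ultimately show "combined_Caputo_deriv a b \<alpha> \<beta> \<gamma>\<^sub>1 \<gamma>\<^sub>2 ?y t
      = combined_Caputo_deriv a b \<alpha> \<beta> \<gamma>\<^sub>1 \<gamma>\<^sub>2 x t + e * Caputo_variation g t"
    unfolding combined_Caputo_eq Caputo_variation_def
      \<alpha>.left_affine[OF c g t] \<beta>.right_affine[OF c g t]
    by (simp add: algebra_simps)
qed

text \<open>Outside [a,b] the value of \<open>deriv_on\<close> is unspecified even for a constant,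
  so the velocity is replaced by 0 under the integrals and not as a function.\<close>

lemma combined_Caputo_zero:
  assumes "t \<in> {a..b}"
  shows "combined_Caputo_deriv a b \<alpha> \<beta> \<gamma>\<^sub>1 \<gamma>\<^sub>2 (\<lambda>_. 0) t = 0"
proof -
  have "deriv_on {a..b} (\<lambda>_. 0) = (\<lambda>t. if t \<in> {a..b} then 0 else deriv_on {a..b} (\<lambda>_. 0) t)"
    using deriv_on_eqI[of "\<lambda>_. 0" 0 _ a b] ab by (auto simp: fun_eq_iff)
  moreover have "left_RL_integral \<alpha> a (\<lambda>t. if t \<in> {a..b} then 0 else deriv_on {a..b} (\<lambda>_. 0) t) t
      = left_RL_integral \<alpha> a (\<lambda>_. 0) t"
    using assms by (intro left_RL_integral_cong) auto
  moreover have "right_RL_integral \<beta> b (\<lambda>t. if t \<in> {a..b} then 0 else deriv_on {a..b} (\<lambda>_. 0) t) t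
      = right_RL_integral \<beta> b (\<lambda>_. 0) t"
    using assms by (intro right_RL_integral_cong) auto
  ultimately show ?thesis
    by (simp add: combined_Caputo_eq Caputo_variation_def left_RL_integral_def right_RL_integral_def
        set_lebesgue_integral_def)
qed

lemma perturbation_small:
  assumes g: "continuous_on {a..b} g"
  obtains K where "0 < K"
    "\<And>e. D_norm a b \<alpha> \<beta> \<gamma>\<^sub>1 \<gamma>\<^sub>2 (\<lambda>t. x t - (x t + e * integral {a..t} g)) 0 \<le> \<bar>e\<bar> * K"
proof -
  obtain M where M: "0 \<le> M" "\<And>t. t \<in> {a..b} \<Longrightarrow> \<bar>integral {a..t} g\<bar> \<le> M"
    using continuous_on_Icc_bounded[OF
        indefinite_integral_continuous_1[OF integrable_continuous_real[OF g]]] by blast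
  obtain N where N: "0 \<le> N" "\<And>t. t \<in> {a..b} \<Longrightarrow> \<bar>Caputo_variation g t\<bar> \<le> N"
    using continuous_on_Icc_bounded[OF Caputo_variation_continuous[OF g]] by blast
  have C1: "C1_on_interval a b (\<lambda>_. 0)"
  proof -
    have "continuous_on {a..b} (deriv_on {a..b} (\<lambda>_. 0))"
      using ab deriv_on_eqI[of "\<lambda>_. 0" 0 _ a b]
      by (intro continuous_on_eq[OF continuous_on_const[of _ 0]]) auto
    then show ?thesis by (simp add: C1_on_interval_def)
  qed
  \<comment> \<open>The summand 1 keeps \<open>K\<close> positive when \<open>g\<close> is 0, so
    that \<epsilon> can be divided by it.\<close>
  show ?thesis
  proof (rule that[of "M + N + 1"])
    fix e
    \<comment> \<open>The difference of the two paths is the zero path perturbed with the factor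
      \<open>- e\<close>, so the perturbation formula applies to it.\<close>
    have y: "(\<lambda>t. x t - (x t + e * integral {a..t} g)) = (\<lambda>t. 0 + (- e) * integral {a..t} g)"
      by auto
    have "(SUP t\<in>{a..b}. \<bar>0 + (- e) * integral {a..t} g\<bar>) \<le> \<bar>e\<bar> * M"
      using ab M by (intro cSUP_least) (auto simp: abs_mult intro!: mult_left_mono)
    moreover have "(SUP t\<in>{a..b}. \<bar>combined_Caputo_deriv a b \<alpha> \<beta> \<gamma>\<^sub>1 \<gamma>\<^sub>2
        (\<lambda>t. 0 + (- e) * integral {a..t} g) t\<bar>) \<le> \<bar>e\<bar> * N"
    proof (rule cSUP_least)
      fix t assume t: "t \<in> {a..b}"
      show "\<bar>combined_Caputo_deriv a b \<alpha> \<beta> \<gamma>\<^sub>1 \<gamma>\<^sub>2 (\<lambda>t. 0 + (- e) * integral {a..t} g) t\<bar>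
          \<le> \<bar>e\<bar> * N"
        unfolding perturbed_Caputo[OF C1 g t] combined_Caputo_zero[OF t]
        using N(2)[OF t] by (auto simp: abs_mult intro!: mult_left_mono)
    qed (use ab in auto)
    ultimately show "D_norm a b \<alpha> \<beta> \<gamma>\<^sub>1 \<gamma>\<^sub>2 (\<lambda>t. x t - (x t + e * integral {a..t} g)) 0
        \<le> \<bar>e\<bar> * (M + N + 1)"
      unfolding D_norm_def y by (simp add: distrib_left)
  qed (use M N in auto)
qed

end

text \<open>Continuity of the two partial derivatives of \<open>L\<close> permits differentiation
  under the integral and makes \<open>p\<close> and \<open>q\<close> continuous. With
  \<open>a < T < b\<close>, the terminal time can move both ways and both subintervals are
  nondegenerate.\<close>

locale combined_minimizer = combined_order a b \<alpha> \<beta> \<gamma>\<^sub>1 \<gamma>\<^sub>2 for a b \<alpha> \<beta> \<gamma>\<^sub>1 \<gamma>\<^sub>2 +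
  fixes L :: "real \<Rightarrow> real \<Rightarrow> real \<Rightarrow> real" and \<phi> :: "real \<Rightarrow> real \<Rightarrow> real"
    and x\<^sub>a T :: real and x :: "real \<Rightarrow> real"
  assumes L_differentiable: "(\<lambda>(t, y, v). L t y v) differentiable_on ({a..b} \<times> UNIV)"
    and D2L_continuous: "continuous_on ({a..b} \<times> UNIV) (\<lambda>(t, y, v). D2L L t y v)"
    and D3L_continuous: "continuous_on ({a..b} \<times> UNIV) (\<lambda>(t, y, v). D3L L t y v)"
    and \<phi>_C1: "C1_terminal_cost a b \<phi>"
    and aT: "a < T" and Tb: "T < b"
    and minimizer: "local_minimizer a b \<alpha> \<beta> \<gamma>\<^sub>1 \<gamma>\<^sub>2 L \<phi> x\<^sub>a x T"
begin

abbreviation v :: "real \<Rightarrow> real" where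
  "v \<equiv> combined_Caputo_deriv a b \<alpha> \<beta> \<gamma>\<^sub>1 \<gamma>\<^sub>2 x"

abbreviation p :: "real \<Rightarrow> real" where
  "p \<equiv> along a b \<alpha> \<beta> \<gamma>\<^sub>1 \<gamma>\<^sub>2 (D3L L) x"

abbreviation q :: "real \<Rightarrow> real" where
  "q \<equiv> along a b \<alpha> \<beta> \<gamma>\<^sub>1 \<gamma>\<^sub>2 (D2L L) x"

lemma x_C1: "C1_on_interval a b x" and v_continuous: "continuous_on {a..b} v"
  and x_continuous: "continuous_on {a..b} x"
  using minimizer
  by (auto simp: local_minimizer_def in_D_def C1_on_interval_def differentiable_imp_continuous_on)

lemma along_continuous:
  assumes F: "continuous_on ({a..b} \<times> UNIV) (\<lambda>(t, y, v). F t y v)"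
  shows "continuous_on {a..b} (along a b \<alpha> \<beta> \<gamma>\<^sub>1 \<gamma>\<^sub>2 F x)"
  unfolding along_def[abs_def]
  by (rule continuous_on_compose_strip[OF F continuous_on_id x_continuous v_continuous])

lemma p_continuous: "continuous_on {a..b} p" and q_continuous: "continuous_on {a..b} q"
  using along_continuous D2L_continuous D3L_continuous by auto

lemma L_continuous: "continuous_on ({a..b} \<times> UNIV) (\<lambda>(t, y, v). L t y v)"
  using L_differentiable by (rule differentiable_imp_continuous_on)

text \<open>Fermat's criterion at \<open>e = 0\<close> for the cost along \<open>x\<close> plus
  \<open>e\<close> times the primitive of \<open>g\<close>, with the terminal time held at
  \<open>T\<close>.\<close>

lemma first_variation:
  assumes g: "continuous_on {a..b} g"
  shows "integral {a..T} (\<lambda>t. q t * integral {a..t} g + p t * Caputo_variation g t)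
    + D2phi \<phi> T (x T) * integral {a..T} g = 0"
proof -
  define h where "h t = integral {a..t} g" for t
  let ?w = "Caputo_variation g"
  have hc: "continuous_on {a..b} h"
    unfolding h_def using g by (intro indefinite_integral_continuous_1 integrable_continuous_real)
  have wc: "continuous_on {a..b} ?w"
    using g by (rule Caputo_variation_continuous)
  let ?f = "\<lambda>e t. L t (x t + e * h t) (v t + e * ?w t)"
  let ?f' = "\<lambda>e t. D2L L t (x t + e * h t) (v t + e * ?w t) * h t
    + D3L L t (x t + e * h t) (v t + e * ?w t) * ?w t"
  define \<Phi> where "\<Phi> e = integral {a..T} (?f e) + \<phi> T (x T + e * h T)" for e
  have fc: "continuous_on {a..T} (?f e)" for e
    using Tb by (intro continuous_on_compose_strip[OF L_continuous] continuous_intros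
        continuous_on_subset[OF x_continuous] continuous_on_subset[OF hc]
        continuous_on_subset[OF v_continuous] continuous_on_subset[OF wc]) auto
  have J: "J_functional a b \<alpha> \<beta> \<gamma>\<^sub>1 \<gamma>\<^sub>2 L \<phi> (\<lambda>t. x t + e * h t) T = \<Phi> e" for e
  proof -
    have "(LBINT t:{a..T}. along a b \<alpha> \<beta> \<gamma>\<^sub>1 \<gamma>\<^sub>2 L (\<lambda>t. x t + e * h t) t) = (LBINT t:{a..T}. ?f e t)"
      using Tb by (intro set_lebesgue_integral_cong)
        (auto simp: along_def h_def perturbed_Caputo[OF x_C1 g])
    then show ?thesis
      by (simp add: J_functional_def \<Phi>_def LBINT_eq_integral[OF fc])
  qed
  have 1: "((\<lambda>e. integral {a..T} (?f e)) has_field_derivative integral {a..T} (?f' 0)) (at 0)"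
  proof -
    let ?D = "(UNIV :: real set) \<times> {a..T}"
    have snd_c: "continuous_on ?D (\<lambda>p. k (snd p))" if "continuous_on {a..b} k" for k :: "real \<Rightarrow> real"
      using Tb by (intro continuous_on_compose2[OF that] continuous_intros) auto
    have D2: "continuous_on ?D (\<lambda>p. D2L L (snd p) (x (snd p) + fst p * h (snd p))
        (v (snd p) + fst p * ?w (snd p)))"
      using Tb by (intro continuous_on_compose_strip[OF D2L_continuous] continuous_intros
          snd_c x_continuous v_continuous hc wc) auto
    have D3: "continuous_on ?D (\<lambda>p. D3L L (snd p) (x (snd p) + fst p * h (snd p))
        (v (snd p) + fst p * ?w (snd p)))"
      using Tb by (intro continuous_on_compose_strip[OF D3L_continuous] continuous_intros
          snd_c x_continuous v_continuous hc wc) auto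
    have "continuous_on (UNIV \<times> cbox a T) (\<lambda>(e, t). ?f' e t)"
      unfolding case_prod_beta cbox_interval
      by (intro continuous_intros D2 D3 snd_c hc wc)
    then have "((\<lambda>e. integral (cbox a T) (?f e)) has_field_derivative integral (cbox a T) (?f' 0))
        (at 0 within UNIV)"
      using Tb fc by (intro leibniz_rule_field_derivative Lagrangian_chain_rule[OF L_differentiable]
          integrable_continuous) auto
    then show ?thesis by simp
  qed
  have 2: "((\<lambda>e. \<phi> T (x T + e * h T)) has_field_derivative D2phi \<phi> T (x T) * h T) (at 0)"
  proof -
    have "((\<lambda>e. (T, x T + e * h T)) has_vector_derivative (0, h T)) (at 0)"
      by (intro has_vector_derivative_Pair has_vector_derivative_const)
        (auto intro!: derivative_eq_intros simp flip: has_real_derivative_iff_has_vector_derivative)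
    moreover obtain \<phi>' where
      "((\<lambda>(t, y). \<phi> t y) has_derivative \<phi>') (at (T, x T) within {a..b} \<times> UNIV)"
      "\<And>r s. \<phi>' (r, s) = D1phi a b \<phi> T (x T) * r + D2phi \<phi> T (x T) * s"
      using terminal_cost_derivative[OF \<phi>_C1 _ ab, of T "x T"] aT Tb by auto
    ultimately show ?thesis
      using has_derivative_within_comp_curve[of "\<lambda>(t, y). \<phi> t y" \<phi>' "\<lambda>e. (T, x T + e * h T)" 0
          "{a..b} \<times> UNIV" "(0, h T)" UNIV] aT Tb by auto
  qed
  have deriv: "(\<Phi> has_field_derivative integral {a..T} (?f' 0) + D2phi \<phi> T (x T) * h T) (at 0)"
    unfolding \<Phi>_def by (rule DERIV_add[OF 1 2])
  obtain \<epsilon> where "\<epsilon> > 0" and min: "\<And>y. in_D a b \<alpha> \<beta> \<gamma>\<^sub>1 \<gamma>\<^sub>2 y T \<Longrightarrow> y a = x\<^sub>a \<Longrightarrow>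
      D_norm a b \<alpha> \<beta> \<gamma>\<^sub>1 \<gamma>\<^sub>2 (\<lambda>t. x t - y t) (T - T) < \<epsilon> \<Longrightarrow>
      J_functional a b \<alpha> \<beta> \<gamma>\<^sub>1 \<gamma>\<^sub>2 L \<phi> x T \<le> J_functional a b \<alpha> \<beta> \<gamma>\<^sub>1 \<gamma>\<^sub>2 L \<phi> y T"
    using minimizer unfolding local_minimizer_def by blast
  obtain K where K: "0 < K"
    "\<And>e. D_norm a b \<alpha> \<beta> \<gamma>\<^sub>1 \<gamma>\<^sub>2 (\<lambda>t. x t - (x t + e * integral {a..t} g)) 0 \<le> \<bar>e\<bar> * K"
    using perturbation_small[OF g] by metis
  \<comment> \<open>The perturbation has norm at most \<open>\<bar>e\<bar> * K\<close>, so this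
    radius keeps it inside the \<epsilon>-ball.\<close>
  have "\<Phi> 0 \<le> \<Phi> e" if "\<bar>0 - e\<bar> < \<epsilon> / K" for e
  proof -
    have "in_D a b \<alpha> \<beta> \<gamma>\<^sub>1 \<gamma>\<^sub>2 (\<lambda>t. x t + e * h t) T"
    proof -
      have "continuous_on {a..b} (combined_Caputo_deriv a b \<alpha> \<beta> \<gamma>\<^sub>1 \<gamma>\<^sub>2 (\<lambda>t. x t + e * h t))"
        by (rule continuous_on_eq[where f = "\<lambda>t. v t + e * ?w t"])
          (auto simp: h_def perturbed_Caputo[OF x_C1 g] intro!: continuous_intros v_continuous wc)
      then show ?thesis
        using aT Tb perturbed_C1[OF x_C1 g] by (simp add: in_D_def h_def)
    qed
    moreover have "x a + e * h a = x\<^sub>a"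
      using minimizer by (simp add: local_minimizer_def h_def)
    moreover have "D_norm a b \<alpha> \<beta> \<gamma>\<^sub>1 \<gamma>\<^sub>2 (\<lambda>t. x t - (x t + e * h t)) (T - T) < \<epsilon>"
      using K(2)[of e] that K(1) by (simp add: h_def field_simps)
    ultimately have "J_functional a b \<alpha> \<beta> \<gamma>\<^sub>1 \<gamma>\<^sub>2 L \<phi> x T
        \<le> J_functional a b \<alpha> \<beta> \<gamma>\<^sub>1 \<gamma>\<^sub>2 L \<phi> (\<lambda>t. x t + e * h t) T"
      by (rule min)
    then show ?thesis
      using J[of 0] J[of e] by simp
  qed
  then have "integral {a..T} (?f' 0) + D2phi \<phi> T (x T) * h T = 0"
    using \<open>\<epsilon> > 0\<close> K(1) by (intro DERIV_local_min[OF deriv, of "\<epsilon> / K"]) auto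
  then show ?thesis
    by (simp add: h_def along_def)
qed

lemma terminal_time_stationary:
  "along a b \<alpha> \<beta> \<gamma>\<^sub>1 \<gamma>\<^sub>2 L x T + D1phi a b \<phi> T (x T) + D2phi \<phi> T (x T) * deriv_on {a..b} x T = 0"
proof -
  let ?l = "along a b \<alpha> \<beta> \<gamma>\<^sub>1 \<gamma>\<^sub>2 L x"
  have lc: "continuous_on {a..b} ?l"
    by (rule along_continuous[OF L_continuous])
  \<comment> \<open>An interior \<open>T\<close> turns the derivative within [a,b] into the
    two-sided one that the minimum criterion asks for.\<close>
  have T: "T \<in> {a..b}" and at: "at T within {a..b} = at T"
    using aT Tb by (auto intro: at_within_Icc_at)
  define \<Phi> where "\<Phi> S = integral {a..S} ?l + \<phi> S (x S)" for S
  have J: "J_functional a b \<alpha> \<beta> \<gamma>\<^sub>1 \<gamma>\<^sub>2 L \<phi> x S = \<Phi> S" if "S \<in> {a..b}" for S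
    using that by (simp add: J_functional_def \<Phi>_def
        LBINT_eq_integral[OF continuous_on_subset[OF lc, of "{a..S}"]])
  obtain \<phi>' where \<phi>': "((\<lambda>(t, y). \<phi> t y) has_derivative \<phi>') (at (T, x T) within {a..b} \<times> UNIV)"
    "\<And>r s. \<phi>' (r, s) = D1phi a b \<phi> T (x T) * r + D2phi \<phi> T (x T) * s"
    using terminal_cost_derivative[OF \<phi>_C1 T ab] by metis
  have "((\<lambda>S. (S, x S)) has_vector_derivative (1, deriv_on {a..b} x T)) (at T within {a..b})"
    by (intro has_vector_derivative_Pair has_vector_derivative_id
        C1_on_interval_has_vector_derivative[OF x_C1 T])
  then have "((\<lambda>S. \<phi> S (x S)) has_field_derivative
      D1phi a b \<phi> T (x T) + D2phi \<phi> T (x T) * deriv_on {a..b} x T) (at T within {a..b})"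
    using \<phi>' has_derivative_within_comp_curve[of "\<lambda>(t, y). \<phi> t y" \<phi>' "\<lambda>S. (S, x S)" T
          "{a..b} \<times> UNIV" "(1, deriv_on {a..b} x T)" "{a..b}"] by auto
  then have deriv: "(\<Phi> has_field_derivative ?l T + (D1phi a b \<phi> T (x T)
      + D2phi \<phi> T (x T) * deriv_on {a..b} x T)) (at T)"
    unfolding \<Phi>_def using DERIV_add[OF integral_has_real_derivative[OF lc T]] at by metis
  obtain \<epsilon> where "\<epsilon> > 0" and min: "\<And>S. in_D a b \<alpha> \<beta> \<gamma>\<^sub>1 \<gamma>\<^sub>2 x S \<Longrightarrow> x a = x\<^sub>a \<Longrightarrow>
      D_norm a b \<alpha> \<beta> \<gamma>\<^sub>1 \<gamma>\<^sub>2 (\<lambda>t. x t - x t) (T - S) < \<epsilon> \<Longrightarrow>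
      J_functional a b \<alpha> \<beta> \<gamma>\<^sub>1 \<gamma>\<^sub>2 L \<phi> x T \<le> J_functional a b \<alpha> \<beta> \<gamma>\<^sub>1 \<gamma>\<^sub>2 L \<phi> x S"
    using minimizer unfolding local_minimizer_def by blast
  \<comment> \<open>With the path unchanged, the distance in D is just the distance of
    \<open>T\<close> and \<open>S\<close>. The last two bounds keep \<open>S\<close> in
    [a,b].\<close>
  have "\<Phi> T \<le> \<Phi> S" if S: "\<bar>T - S\<bar> < min \<epsilon> (min (T - a) (b - T))" for S
  proof -
    have "(SUP t\<in>{a..b}. \<bar>combined_Caputo_deriv a b \<alpha> \<beta> \<gamma>\<^sub>1 \<gamma>\<^sub>2 (\<lambda>t. 0) t\<bar>) = (SUP t\<in>{a..b}. 0)"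
      by (intro SUP_cong) (auto simp: combined_Caputo_zero)
    then have "D_norm a b \<alpha> \<beta> \<gamma>\<^sub>1 \<gamma>\<^sub>2 (\<lambda>t. x t - x t) (T - S) < \<epsilon>"
      using S ab by (simp add: D_norm_def)
    moreover have "S \<in> {a..b}" using S by auto
    ultimately have "J_functional a b \<alpha> \<beta> \<gamma>\<^sub>1 \<gamma>\<^sub>2 L \<phi> x T \<le> J_functional a b \<alpha> \<beta> \<gamma>\<^sub>1 \<gamma>\<^sub>2 L \<phi> x S"
      using minimizer by (intro min) (auto simp: local_minimizer_def in_D_def)
    then show ?thesis
      using J \<open>S \<in> {a..b}\<close> T by simp
  qed
  then have "?l T + (D1phi a b \<phi> T (x T) + D2phi \<phi> T (x T) * deriv_on {a..b} x T) = 0"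
    using \<open>\<epsilon> > 0\<close> aT Tb
    by (intro DERIV_local_min[OF deriv, of "min \<epsilon> (min (T - a) (b - T))"]) auto
  then show ?thesis by simp
qed

end

section \<open>Weak, integrated and pointwise Euler-Lagrange equations\<close>

lemma left_RL_integral_base [simp]: "left_RL_integral \<delta> c f c = 0"
proof -
  have "(\<lambda>\<tau>. indicator {c..c} \<tau> *\<^sub>R (RL_kernel \<delta> c \<tau> * f \<tau>)) = (\<lambda>_. 0)"
    by (auto simp: fun_eq_iff indicator_def)
  then show ?thesis
    by (simp add: left_RL_integral_kernel set_lebesgue_integral_def)
qed

lemma right_RL_integral_base [simp]: "right_RL_integral \<delta> c f c = 0"
  by (simp add: right_RL_integral_reflect)

lemma deriv_on_eq_zeroI:
  assumes "\<And>s. s \<in> {c..d} \<Longrightarrow> f s = 0" "c < d" "t \<in> {c..d}"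
  shows "deriv_on {c..d} f t = 0"
proof (rule deriv_on_eqI)
  show "(f has_vector_derivative 0) (at t within {c..d})"
    by (rule has_vector_derivative_transform[of t _ f "\<lambda>_. 0"]) (use assms in auto)
qed fact+

context combined_minimizer
begin

sublocale \<alpha>T: variable_order a T \<alpha>
  using aT Tb by (intro \<alpha>.restrict) auto

sublocale T\<beta>: variable_order T b \<beta>
  using aT Tb by (intro \<beta>.restrict) auto

text \<open>The left \<alpha>-operator looks back, so its term is integrated by parts on [a,T] and
  yields a right integral ending at \<open>T\<close>. The right \<beta>-operator looks ahead to
  \<open>b\<close> and is treated on [a,b] with \<open>p\<close> cut off at
  \<open>T\<close>.\<close>

lemma weak_equation_before:
  assumes g: "continuous_on UNIV g" and g0: "\<And>t. t \<notin> {a<..<T} \<Longrightarrow> g t = 0"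
  shows "integral {a..T} (\<lambda>t. g t * (integral {a..T} q - integral {a..t} q
      + \<gamma>\<^sub>1 * right_RL_integral \<alpha> T p t - \<gamma>\<^sub>2 * left_RL_integral \<beta> a p t + D2phi \<phi> T (x T))) = 0"
proof -
  have sub: "{a..T} \<subseteq> {a..b}" using Tb by auto
  have gc: "continuous_on S g" for S
    using g continuous_on_subset by blast
  have pT: "continuous_on {a..T} p" and qT: "continuous_on {a..T} q"
    using p_continuous q_continuous sub continuous_on_subset by blast+
  note c = gc pT qT \<alpha>T.left_continuous[OF gc] \<alpha>T.right_continuous[OF pT]
    continuous_on_subset[OF \<beta>.left_continuous[OF p_continuous] sub]
    continuous_on_subset[OF \<beta>.right_continuous[OF gc] sub]
    indefinite_integral_continuous_1[OF integrable_continuous_real[OF gc]]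
    indefinite_integral_continuous_1[OF integrable_continuous_real[OF qT]]
  obtain M where M: "\<And>t. t \<in> {a..T} \<Longrightarrow> \<bar>p t\<bar> \<le> M"
    using continuous_on_Icc_bounded[OF pT] by blast
  obtain N where N: "\<And>t. t \<in> {a..T} \<Longrightarrow> \<bar>g t\<bar> \<le> N"
    using continuous_on_Icc_bounded[OF gc] by blast
  have 1: "integral {a..T} (\<lambda>t. p t * left_RL_integral \<alpha> a g t)
      = integral {a..T} (\<lambda>t. g t * right_RL_integral \<alpha> T p t)"
    using \<alpha>T.integration_by_parts[OF set_borel_measurable_continuous_Icc[OF pT] M
        set_borel_measurable_continuous_Icc[OF gc] N]
    by (simp add: LBINT_eq_integral c continuous_on_mult)
  have "(LBINT t:{a..b}. g t * left_RL_integral \<beta> a (\<lambda>\<tau>. indicator {a..T} \<tau> * p \<tau>) t)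
      = (LBINT t:{a..T}. g t * left_RL_integral \<beta> a p t)"
    unfolding set_lebesgue_integral_def
  proof (intro Bochner_Integration.integral_cong refl)
    fix t
    show "indicator {a..b} t *\<^sub>R (g t * left_RL_integral \<beta> a (\<lambda>\<tau>. indicator {a..T} \<tau> * p \<tau>) t)
        = indicator {a..T} t *\<^sub>R (g t * left_RL_integral \<beta> a p t)"
    proof (cases "t \<in> {a<..<T}")
      case True
      \<comment> \<open>Before \<open>T\<close> the left integral does not see the cut-off; outside
        \<open>(a,T)\<close> the factor \<open>g\<close> is 0.\<close>
      then have "left_RL_integral \<beta> a (\<lambda>\<tau>. indicator {a..T} \<tau> * p \<tau>) t = left_RL_integral \<beta> a p t"
        by (intro left_RL_integral_cong) auto
      then show ?thesis using True Tb by simp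
    qed (simp add: g0)
  qed
  then have 2: "integral {a..T} (\<lambda>t. p t * right_RL_integral \<beta> b g t)
      = integral {a..T} (\<lambda>t. g t * left_RL_integral \<beta> a p t)"
    using \<beta>.integration_by_parts_truncated[OF p_continuous gc, of T] aT Tb
    by (simp add: LBINT_eq_integral c continuous_on_mult)
  note 3 = integral_primitive_swap[OF qT gc less_imp_le[OF aT]]
  have "integral {a..T} (\<lambda>t. q t * integral {a..t} g + p t * Caputo_variation g t)
      = integral {a..T} (\<lambda>t. q t * integral {a..t} g
          + \<gamma>\<^sub>1 * (p t * left_RL_integral \<alpha> a g t) - \<gamma>\<^sub>2 * (p t * right_RL_integral \<beta> b g t))"
    by (simp add: Caputo_variation_def algebra_simps)
  also have "\<dots> = integral {a..T} (\<lambda>t. g t * (integral {a..T} q - integral {a..t} q))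
      + \<gamma>\<^sub>1 * integral {a..T} (\<lambda>t. g t * right_RL_integral \<alpha> T p t)
      - \<gamma>\<^sub>2 * integral {a..T} (\<lambda>t. g t * left_RL_integral \<beta> a p t)"
    unfolding 1[symmetric] 2[symmetric] 3[symmetric]
    by (simp add: integral_diff integral_add integrable_continuous_real continuous_intros c)
  finally have "integral {a..T} (\<lambda>t. g t * (integral {a..T} q - integral {a..t} q))
      + \<gamma>\<^sub>1 * integral {a..T} (\<lambda>t. g t * right_RL_integral \<alpha> T p t)
      - \<gamma>\<^sub>2 * integral {a..T} (\<lambda>t. g t * left_RL_integral \<beta> a p t)
      + D2phi \<phi> T (x T) * integral {a..T} g = 0"
    using first_variation[OF gc] by simp
  also have "integral {a..T} (\<lambda>t. g t * (integral {a..T} q - integral {a..t} q))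
      + \<gamma>\<^sub>1 * integral {a..T} (\<lambda>t. g t * right_RL_integral \<alpha> T p t)
      - \<gamma>\<^sub>2 * integral {a..T} (\<lambda>t. g t * left_RL_integral \<beta> a p t)
      + D2phi \<phi> T (x T) * integral {a..T} g
    = integral {a..T} (\<lambda>t. g t * (integral {a..T} q - integral {a..t} q)
      + \<gamma>\<^sub>1 * (g t * right_RL_integral \<alpha> T p t) - \<gamma>\<^sub>2 * (g t * left_RL_integral \<beta> a p t)
      + D2phi \<phi> T (x T) * g t)"
    by (simp add: integral_diff integral_add integrable_continuous_real continuous_intros c)
  finally show ?thesis
    by (simp add: algebra_simps)
qed

text \<open>A velocity supported after \<open>T\<close> leaves the path unchanged up to
  \<open>T\<close>, so the terms of \<open>q\<close>, \<alpha> and \<phi> vanish. Only the right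
  \<beta>-operator, which looks ahead, still feels it.\<close>

lemma weak_equation_after:
  assumes g: "continuous_on UNIV g" and g0: "\<And>t. t \<notin> {T<..<b} \<Longrightarrow> g t = 0"
  shows "integral {T..b} (\<lambda>t. g t
    * (\<gamma>\<^sub>2 * (left_RL_integral \<beta> T p t - left_RL_integral \<beta> a p t))) = 0"
proof -
  have sub: "{a..T} \<subseteq> {a..b}" "{T..b} \<subseteq> {a..b}" using aT Tb by auto
  have gc: "continuous_on S g" for S
    using g continuous_on_subset by blast
  have pT: "continuous_on {a..T} p" and Tp: "continuous_on {T..b} p"
    using p_continuous sub continuous_on_subset by blast+
  have "integral {a..t} g = 0" if "t \<le> T" for t
    using that by (subst integral_cong[of _ _ "\<lambda>_. 0"]) (auto intro: g0)
  moreover have "left_RL_integral \<alpha> a g t = 0" if "t \<le> T" for t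
    using left_RL_integral_cong[of a t g "\<lambda>_. 0"] that
    by (simp add: g0 left_RL_integral_def set_lebesgue_integral_def)
  ultimately have "integral {a..T} (\<lambda>t. q t * integral {a..t} g + p t * Caputo_variation g t)
      = integral {a..T} (\<lambda>t. - \<gamma>\<^sub>2 * (p t * right_RL_integral \<beta> b g t))"
    by (intro integral_cong) (simp add: Caputo_variation_def)
  then have "\<gamma>\<^sub>2 * integral {a..T} (\<lambda>t. p t * right_RL_integral \<beta> b g t) = 0"
    using first_variation[OF gc] \<open>\<And>t. t \<le> T \<Longrightarrow> integral {a..t} g = 0\<close> by simp
  also have "integral {a..T} (\<lambda>t. p t * right_RL_integral \<beta> b g t)
      = (LBINT t:{a..T}. p t * right_RL_integral \<beta> b g t)"
    by (intro LBINT_eq_integral[symmetric] continuous_on_mult pT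
        continuous_on_subset[OF \<beta>.right_continuous[OF gc] sub(1)])
  also have "\<dots> = (LBINT t:{a..b}. g t * left_RL_integral \<beta> a (\<lambda>\<tau>. indicator {a..T} \<tau> * p \<tau>) t)"
    using \<beta>.integration_by_parts_truncated[OF p_continuous gc, of T] aT Tb by simp
  also have "\<dots> = (LBINT t:{T..b}. g t * (left_RL_integral \<beta> a p t - left_RL_integral \<beta> T p t))"
    unfolding set_lebesgue_integral_def
  proof (intro Bochner_Integration.integral_cong refl)
    fix t
    show "indicator {a..b} t *\<^sub>R (g t * left_RL_integral \<beta> a (\<lambda>\<tau>. indicator {a..T} \<tau> * p \<tau>) t)
        = indicator {T..b} t *\<^sub>R (g t * (left_RL_integral \<beta> a p t - left_RL_integral \<beta> T p t))"
      using aT Tb \<beta>.left_truncated[OF p_continuous, of T t]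
      by (cases "t \<in> {T<..<b}") (auto simp: g0)
  qed
  also have "\<dots> = integral {T..b} (\<lambda>t. g t * (left_RL_integral \<beta> a p t - left_RL_integral \<beta> T p t))"
    by (intro LBINT_eq_integral continuous_intros gc T\<beta>.left_continuous[OF Tp]
        continuous_on_subset[OF \<beta>.left_continuous[OF p_continuous] sub(2)])
  finally have "- \<gamma>\<^sub>2 * integral {T..b} (\<lambda>t. g t * (left_RL_integral \<beta> a p t - left_RL_integral \<beta> T p t)) = 0"
    by simp
  then have "integral {T..b} (\<lambda>t. - \<gamma>\<^sub>2 * (g t * (left_RL_integral \<beta> a p t - left_RL_integral \<beta> T p t))) = 0"
    by (simp only: integral_mult_right)
  then show ?thesis
    by (simp add: algebra_simps)
qed

text \<open>The du Bois-Reymond form: it needs no differentiability of the fractional integrals of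
  \<open>p\<close>, and at \<open>t = T\<close> the two integrals of \<open>q\<close>
  cancel.\<close>

lemma integrated_equation_before:
  assumes "t \<in> {a..T}"
  shows "integral {a..T} q - integral {a..t} q + \<gamma>\<^sub>1 * right_RL_integral \<alpha> T p t
    - \<gamma>\<^sub>2 * left_RL_integral \<beta> a p t + D2phi \<phi> T (x T) = 0"
proof (rule fundamental_lemma_calculus_of_variations[OF aT _ weak_equation_before assms])
  have sub: "{a..T} \<subseteq> {a..b}" using Tb by auto
  show "continuous_on {a..T} (\<lambda>t. integral {a..T} q - integral {a..t} q
      + \<gamma>\<^sub>1 * right_RL_integral \<alpha> T p t - \<gamma>\<^sub>2 * left_RL_integral \<beta> a p t + D2phi \<phi> T (x T))"
    by (intro continuous_intros \<alpha>T.right_continuous indefinite_integral_continuous_1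
        integrable_continuous_real continuous_on_subset[OF p_continuous sub]
        continuous_on_subset[OF q_continuous sub]
        continuous_on_subset[OF \<beta>.left_continuous[OF p_continuous] sub])
qed

lemma integrated_equation_after:
  assumes "t \<in> {T..b}"
  shows "\<gamma>\<^sub>2 * (left_RL_integral \<beta> T p t - left_RL_integral \<beta> a p t) = 0"
proof (rule fundamental_lemma_calculus_of_variations[OF Tb _ weak_equation_after assms])
  have sub: "{T..b} \<subseteq> {a..b}" using aT by auto
  show "continuous_on {T..b} (\<lambda>t. \<gamma>\<^sub>2 * (left_RL_integral \<beta> T p t - left_RL_integral \<beta> a p t))"
    by (intro continuous_intros T\<beta>.left_continuous continuous_on_subset[OF p_continuous sub]
        continuous_on_subset[OF \<beta>.left_continuous[OF p_continuous] sub])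
qed

lemma Euler_Lagrange_before:
  assumes t: "t \<in> {a..T}" and diff: "dual_differentiable a T \<alpha> \<beta> \<gamma>\<^sub>1 \<gamma>\<^sub>2 p t"
  shows "q t + dual_deriv a T \<alpha> \<beta> \<gamma>\<^sub>1 \<gamma>\<^sub>2 p t = 0"
proof -
  let ?R = "right_RL_integral \<alpha> T p" and ?Lf = "left_RL_integral \<beta> a p"
  have sub: "{a..T} \<subseteq> {a..b}" using Tb by auto
  have R: "((\<lambda>s. \<gamma>\<^sub>1 * ?R s) has_vector_derivative \<gamma>\<^sub>1 * deriv_on {a..T} ?R t) (at t within {a..T})"
  \<comment> \<open>For coefficient 0 the hypothesis says nothing about this integral, but the
    product is constantly 0.\<close>
  proof (cases "\<gamma>\<^sub>1 = 0")
    case False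
    then show ?thesis
      using diff unfolding dual_differentiable_def right_RL_differentiable_def deriv_on_def
      by (intro has_vector_derivative_mult_right) (simp add: vector_derivative_works)
  qed simp
  have Lf: "((\<lambda>s. \<gamma>\<^sub>2 * ?Lf s) has_vector_derivative \<gamma>\<^sub>2 * deriv_on {a..T} ?Lf t) (at t within {a..T})"
  proof (cases "\<gamma>\<^sub>2 = 0")
    case False
    then show ?thesis
      using diff unfolding dual_differentiable_def left_RL_differentiable_def deriv_on_def
      by (intro has_vector_derivative_mult_right) (simp add: vector_derivative_works)
  qed simp
  have "((\<lambda>t. integral {a..T} q - integral {a..t} q + \<gamma>\<^sub>1 * ?R t - \<gamma>\<^sub>2 * ?Lf t + D2phi \<phi> T (x T))
      has_vector_derivative 0 - q t + \<gamma>\<^sub>1 * deriv_on {a..T} ?R t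
        - \<gamma>\<^sub>2 * deriv_on {a..T} ?Lf t + 0) (at t within {a..T})"
    by (intro has_vector_derivative_add has_vector_derivative_diff has_vector_derivative_const
        integral_has_vector_derivative R Lf continuous_on_subset[OF q_continuous sub] t)
  \<comment> \<open>The same function has this derivative and derivative 0. The minus sign in
    \<open>right_RL_deriv\<close> accounts for the sign of the \<alpha>-term.\<close>
  from deriv_on_eqI[OF this aT t] deriv_on_eq_zeroI[OF integrated_equation_before aT t]
  show ?thesis
    by (simp add: dual_deriv_def left_RL_deriv_def right_RL_deriv_def)
qed

lemma Euler_Lagrange_after:
  assumes t: "t \<in> {T..b}" and "left_RL_differentiable {T..b} \<beta> a p t"
    and "left_RL_differentiable {T..b} \<beta> T p t"
  shows "\<gamma>\<^sub>2 * (left_RL_deriv {T..b} \<beta> a p t - left_RL_deriv {T..b} \<beta> T p t) = 0"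
proof -
  have "((\<lambda>t. \<gamma>\<^sub>2 * (left_RL_integral \<beta> T p t - left_RL_integral \<beta> a p t)) has_vector_derivative
      \<gamma>\<^sub>2 * (left_RL_deriv {T..b} \<beta> T p t - left_RL_deriv {T..b} \<beta> a p t)) (at t within {T..b})"
    using assms unfolding left_RL_differentiable_def left_RL_deriv_def deriv_on_def
    by (intro has_vector_derivative_mult_right has_vector_derivative_diff)
      (simp_all add: vector_derivative_works)
  from deriv_on_eqI[OF this Tb t] deriv_on_eq_zeroI[OF integrated_equation_after Tb t]
  show ?thesis
    by auto
qed

text \<open>Both Riemann--Liouville integrals based at \<open>T\<close> vanish at \<open>T\<close>, so the second transversality
  condition reduces to this equation; it comes from comparing the two integrated equations at \<open>T\<close>.\<close>

lemma terminal_state_stationary: "D2phi \<phi> T (x T) = 0"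
proof -
  have "D2phi \<phi> T (x T) = \<gamma>\<^sub>2 * left_RL_integral \<beta> a p T"
    using integrated_equation_before[of T] aT by simp
  then show ?thesis
    using integrated_equation_after[of T] Tb by simp
qed

end

text \<open>Continuity of \<open>p\<close> does not make its Riemann-Liouville integrals
  differentiable, so the pointwise equations are asserted where the derivatives exist. The last two
  transversality conditions contain only integrals of \<open>p\<close> and hold
  unconditionally.\<close>

theorem theorem45:
  fixes a b \<gamma>\<^sub>1 \<gamma>\<^sub>2 x\<^sub>a T :: real
    and \<alpha> \<beta> :: "real \<Rightarrow> real \<Rightarrow> real"
    and L :: "real \<Rightarrow> real \<Rightarrow> real \<Rightarrow> real"
    and \<phi> :: "real \<Rightarrow> real \<Rightarrow> real"
    and x :: "real \<Rightarrow> real"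
  assumes "a < b"
    and "continuous_on ({a..b} \<times> {a..b}) (\<lambda>(s, t). \<alpha> s t)"
    and "\<And>s t. s \<in> {a..b} \<Longrightarrow> t \<in> {a..b} \<Longrightarrow> \<alpha> s t \<in> {0<..<1}"
    and "continuous_on ({a..b} \<times> {a..b}) (\<lambda>(s, t). \<beta> s t)"
    and "\<And>s t. s \<in> {a..b} \<Longrightarrow> t \<in> {a..b} \<Longrightarrow> \<beta> s t \<in> {0<..<1}"
    and "\<gamma>\<^sub>1 \<in> {0..1}" and "\<gamma>\<^sub>2 \<in> {0..1}" and "\<not> (\<gamma>\<^sub>1 = 0 \<and> \<gamma>\<^sub>2 = 0)"
    and L_differentiable: "(\<lambda>(t, y, v). L t y v) differentiable_on ({a..b} \<times> UNIV)"
    and D2L_continuous: "continuous_on ({a..b} \<times> UNIV) (\<lambda>(t, y, v). D2L L t y v)"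
    and D3L_continuous: "continuous_on ({a..b} \<times> UNIV) (\<lambda>(t, y, v). D3L L t y v)"
    and "C1_terminal_cost a b \<phi>"
    and T_free: "a < T" "T < b"
    and "local_minimizer a b \<alpha> \<beta> \<gamma>\<^sub>1 \<gamma>\<^sub>2 L \<phi> x\<^sub>a x T"
  shows "let p = along a b \<alpha> \<beta> \<gamma>\<^sub>1 \<gamma>\<^sub>2 (D3L L) x in
      (\<forall>t\<in>{a..T}. dual_differentiable a T \<alpha> \<beta> \<gamma>\<^sub>1 \<gamma>\<^sub>2 p t \<longrightarrow>
         along a b \<alpha> \<beta> \<gamma>\<^sub>1 \<gamma>\<^sub>2 (D2L L) x t + dual_deriv a T \<alpha> \<beta> \<gamma>\<^sub>1 \<gamma>\<^sub>2 p t = 0) \<and>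
      (\<forall>t\<in>{T..b}. left_RL_differentiable {T..b} \<beta> a p t \<and> left_RL_differentiable {T..b} \<beta> T p t \<longrightarrow>
         \<gamma>\<^sub>2 * (left_RL_deriv {T..b} \<beta> a p t - left_RL_deriv {T..b} \<beta> T p t) = 0) \<and>
      along a b \<alpha> \<beta> \<gamma>\<^sub>1 \<gamma>\<^sub>2 L x T + D1phi a b \<phi> T (x T) + D2phi \<phi> T (x T) * deriv_on {a..b} x T = 0 \<and>
      (\<gamma>\<^sub>1 * right_RL_integral \<alpha> T p T - \<gamma>\<^sub>2 * left_RL_integral \<beta> T p T) + D2phi \<phi> T (x T) = 0 \<and>
      \<gamma>\<^sub>2 * (left_RL_integral \<beta> T p b - left_RL_integral \<beta> a p b) = 0"
proof -
  interpret combined_minimizer a b \<alpha> \<beta> \<gamma>\<^sub>1 \<gamma>\<^sub>2 L \<phi> x\<^sub>a T x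
    by unfold_locales (use assms in \<open>simp_all\<close>)
  show ?thesis
    using Euler_Lagrange_before Euler_Lagrange_after terminal_time_stationary
      terminal_state_stationary integrated_equation_after[of b] Tb
    by (simp add: Let_def)
qed

end
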